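(* Let $(M^n,g,f,\tau)$ be a closed orientable gradient Ricci shrinker, let $h$-independent data $\omega\in\Omega^1(M)$ and $a\in C^\infty(M)$ be arbitrary. Then $$\Delta_f\, da = d\,\Delta_f a+\frac{1}{2\tau}\,da,$$ $$\mathrm{div}_f\,\Delta_f\omega=\Delta_f\,\mathrm{div}_f\,\omega+\frac{1}{2\tau}\,\mathrm{div}_f\,\omega,$$ $$\mathcal{L}_{\#(\Delta_f\omega)}g=\Delta_{f,L}\big(\mathcal{L}_{\#\omega}g\big)+\frac{1}{2\tau}\,\mathcal{L}_{\#\omega}g .$$
   Context: A closed orientable gradient Ricci shrinker $(M^n,g,f,\tau)$ is a closed orientable Riemannian manifold $(M^n,g)$ with $f\in C^\infty(M)$ and a constant $\tau>0$ such that $\mathrm{Ric}+\nabla^2 f=\frac{1}{2\tau}g$; $f$ is normalized by $\int_M dm=1$, where $dm=(4\pi\tau)^{-n/2}e^{-f}dv$. Curvature convention: $Rm(X,Y,Z,W)=-\langle R(X,Y)Z,W\rangle$, so that $\nabla_i\nabla_j\omega_k=\nabla_j\nabla_i\omega_k+R_{ijkp}\omega^p$ and $R_{ij}=g^{pq}R_{piqj}$. For a symmetric 2-tensor $h$, $Rm(h,-)_{ij}=R_{piqj}h^{pq}$. For a 1-form $\omega$, $\mathrm{div}_f\omega=g^{pq}(\nabla_p\omega_q-\omega_p\nabla_q f)$, $\#\omega$ is the metric dual vector field, and $\mathcal{L}$ is the Lie derivative, so $(\mathcal{L}_{\#\omega}g)_{ij}=\nabla_i\omega_j+\nabla_j\omega_i$.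 On functions, 1-forms and symmetric 2-tensors, $\Delta_f=\Delta-\nabla_{\nabla f}$, where $\Delta=g^{pq}\nabla_p\nabla_q$ is the rough Laplacian. The weighted Lichnerowicz Laplacian on symmetric 2-tensors of a shrinker is $\Delta_{f,L}h=\Delta_f h+2Rm(h,-)-\frac1\tau h$. *)

theory Defs
  imports "HOL-Analysis.Analysis"
begin

section \<open>Smooth functions on open subsets of Euclidean space\<close>

definition partial_deriv :: "'n::finite \<Rightarrow> (real^'n \<Rightarrow> real) \<Rightarrow> real^'n \<Rightarrow> real" where
  "partial_deriv i F x = frechet_derivative F (at x) (axis i 1)"

fun Ck_on :: "nat \<Rightarrow> (real^'n) set \<Rightarrow> (real^'n::finite \<Rightarrow> real) \<Rightarrow> bool" where
  "Ck_on 0 S F \<longleftrightarrow> continuous_on S F"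
| "Ck_on (Suc k) S F \<longleftrightarrow> F differentiable_on S \<and> (\<forall>i. Ck_on k S (partial_deriv i F))"

text \<open>Only used for open \<open>S\<close>.\<close>
definition smooth_on :: "(real^'n) set \<Rightarrow> (real^'n::finite \<Rightarrow> real) \<Rightarrow> bool" where
  "smooth_on S F \<longleftrightarrow> (\<forall>k. Ck_on k S F)"

section \<open>Smooth manifolds\<close>

text \<open>A chart is a pair of its domain and its coordinate map.  The coordinate map is a total
  function whose values outside the domain are irrelevant.\<close>
type_synonym ('a, 'n) chart = "'a set \<times> ('a \<Rightarrow> real^'n)"

definition chart_inv :: "('a, 'n::finite) chart \<Rightarrow> real^'n \<Rightarrow> 'a" where
  "chart_inv c = inv_into (fst c) (snd c)"

definition is_chart :: "'a topology \<Rightarrow> ('a, 'n::finite) chart \<Rightarrow> bool" where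
  "is_chart M c \<longleftrightarrow> openin M (fst c) \<and> open (snd c ` fst c) \<and>
     homeomorphic_map (subtopology M (fst c)) (top_of_set (snd c ` fst c)) (snd c)"

definition smooth_transition :: "('a, 'n::finite) chart \<Rightarrow> ('a, 'n) chart \<Rightarrow> bool" where
  "smooth_transition c c' \<longleftrightarrow>
     (\<forall>i. smooth_on (snd c ` (fst c \<inter> fst c')) (\<lambda>x. snd c' (chart_inv c x) $ i))"

text \<open>A smooth structure is a maximal smooth atlas.\<close>
definition smooth_structure :: "'a topology \<Rightarrow> ('a, 'n::finite) chart set \<Rightarrow> bool" where
  "smooth_structure M A \<longleftrightarrow>
     (\<forall>c\<in>A. is_chart M c) \<and>
     (\<Union>c\<in>A. fst c) = topspace M \<and>
     (\<forall>c\<in>A. \<forall>c'\<in>A. smooth_transition c c') \<and>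
     (\<forall>c. is_chart M c \<and> (\<forall>c'\<in>A. smooth_transition c c' \<and> smooth_transition c' c) \<longrightarrow> c \<in> A)"

definition smooth_manifold :: "'a topology \<Rightarrow> ('a, 'n::finite) chart set \<Rightarrow> bool" where
  "smooth_manifold M A \<longleftrightarrow> Hausdorff_space M \<and> second_countable M \<and> smooth_structure M A"

text \<open>The coordinate vector field \<open>\<partial>/\<partial>x\<^sup>i\<close> of the chart \<open>c\<close> at \<open>p\<close>, acting on a function
  defined near \<open>p\<close>.\<close>
definition coord_deriv :: "('a, 'n::finite) chart \<Rightarrow> 'n \<Rightarrow> ('a \<Rightarrow> real) \<Rightarrow> 'a \<Rightarrow> real" where
  "coord_deriv c i F p = partial_deriv i (\<lambda>x. F (chart_inv c x)) (snd c p)"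

text \<open>\<open>jacobian c c' p j i\<close> is \<open>\<partial>x\<^sup>j/\<partial>y\<^sup>i\<close> at \<open>p\<close>, where \<open>x\<close> are the coordinates of \<open>c\<close> and
  \<open>y\<close> those of \<open>c'\<close>.\<close>
definition jacobian :: "('a, 'n::finite) chart \<Rightarrow> ('a, 'n) chart \<Rightarrow> 'a \<Rightarrow> 'n \<Rightarrow> 'n \<Rightarrow> real" where
  "jacobian c c' p j i = coord_deriv c' i (\<lambda>q. snd c q $ j) p"

definition orientable :: "'a topology \<Rightarrow> ('a, 'n::finite) chart set \<Rightarrow> bool" where
  "orientable M A \<longleftrightarrow>
     (\<exists>B\<subseteq>A. (\<Union>c\<in>B. fst c) = topspace M \<and>
        (\<forall>c\<in>B. \<forall>c'\<in>B. \<forall>p\<in>fst c \<inter> fst c'. det (\<chi> j i. jacobian c c' p j i) > 0))"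

definition smooth_function :: "('a, 'n::finite) chart set \<Rightarrow> ('a \<Rightarrow> real) \<Rightarrow> bool" where
  "smooth_function A a \<longleftrightarrow> (\<forall>c\<in>A. smooth_on (snd c ` fst c) (\<lambda>x. a (chart_inv c x)))"

section \<open>Tensor fields\<close>

text \<open>A covariant tensor field \<open>T\<close> of rank \<open>k\<close> is given by its components in all charts:
  \<open>T c p [i, j, \<dots>]\<close> is the value of \<open>T\<close> at \<open>p\<close> on the coordinate vector fields
  \<open>\<partial>\<^sub>i, \<partial>\<^sub>j, \<dots>\<close> of the chart \<open>c\<close>.  The components have to be smooth and to
  transform tensorially under changes of charts.  Only the values at points \<open>p\<close> of the domain
  of \<open>c\<close> and at index lists of length \<open>k\<close> are meaningful.\<close>
type_synonym ('a, 'n) tensor = "('a, 'n) chart \<Rightarrow> 'a \<Rightarrow> 'n list \<Rightarrow> real"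

definition tensor_field ::
    "('a, 'n::finite) chart set \<Rightarrow> nat \<Rightarrow> ('a, 'n) tensor \<Rightarrow> bool" where
  "tensor_field A k T \<longleftrightarrow>
     (\<forall>c\<in>A. \<forall>is. length is = k \<longrightarrow> smooth_on (snd c ` fst c) (\<lambda>x. T c (chart_inv c x) is)) \<and>
     (\<forall>c\<in>A. \<forall>c'\<in>A. \<forall>p\<in>fst c \<inter> fst c'. \<forall>is. length is = k \<longrightarrow>
        T c' p is = (\<Sum>js | length js = k. (\<Prod>l<k. jacobian c c' p (js ! l) (is ! l)) * T c p js))"

text \<open>A function, viewed as a tensor field of rank 0.\<close>
definition scalar :: "('a \<Rightarrow> real) \<Rightarrow> ('a, 'n) tensor" where
  "scalar a = (\<lambda>c p is. a p)"

text \<open>The exterior derivative of a tensor field of rank 0.\<close>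
definition differential :: "('a, 'n::finite) tensor \<Rightarrow> ('a, 'n) tensor" where
  "differential T = (\<lambda>c p is. coord_deriv c (hd is) (\<lambda>q. T c q []) p)"

section \<open>Riemannian metrics\<close>

definition riemannian_metric ::
    "('a, 'n::finite) chart set \<Rightarrow> ('a, 'n) tensor \<Rightarrow> bool" where
  "riemannian_metric A g \<longleftrightarrow> tensor_field A 2 g \<and>
     (\<forall>c\<in>A. \<forall>p\<in>fst c.
        (\<forall>i j. g c p [i, j] = g c p [j, i]) \<and>
        (\<forall>v::real^'n. v \<noteq> 0 \<longrightarrow> (\<Sum>i\<in>UNIV. \<Sum>j\<in>UNIV. g c p [i, j] * v $ i * v $ j) > 0))"

definition metric_matrix ::
    "('a, 'n::finite) tensor \<Rightarrow> ('a, 'n) chart \<Rightarrow> 'a \<Rightarrow> real^'n^'n" where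
  "metric_matrix g c p = (\<chi> i j. g c p [i, j])"

text \<open>\<open>g\<^sup>i\<^sup>j\<close>\<close>
definition inv_metric ::
    "('a, 'n::finite) tensor \<Rightarrow> ('a, 'n) chart \<Rightarrow> 'a \<Rightarrow> 'n \<Rightarrow> 'n \<Rightarrow> real" where
  "inv_metric g c p i j = matrix_inv (metric_matrix g c p) $ i $ j"

text \<open>The Riemannian volume measure \<open>dv\<close>: the unique Borel measure on \<open>M\<close> that has density
  \<open>sqrt (det g)\<close> with respect to Lebesgue measure in every chart.\<close>
definition riemannian_volume ::
    "'a topology \<Rightarrow> ('a, 'n::finite) chart set \<Rightarrow> ('a, 'n) tensor \<Rightarrow> 'a measure" where
  "riemannian_volume M A g = (THE \<mu>.
     space \<mu> = topspace M \<and>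
     sets \<mu> = sigma_sets (topspace M) {U. openin M U} \<and>
     (\<forall>c\<in>A. \<forall>B\<in>sets \<mu>. B \<subseteq> fst c \<longrightarrow>
        emeasure \<mu> B =
          (\<integral>\<^sup>+x\<in>snd c ` B. ennreal (sqrt (det (metric_matrix g c (chart_inv c x)))) \<partial>lborel)))"

section \<open>Levi-Civita connection and curvature\<close>

text \<open>\<open>christoffel g c p k i j\<close> is
  \<open>\<Gamma>\<^sup>k\<^sub>i\<^sub>j = 1/2 g\<^sup>k\<^sup>l (\<partial>\<^sub>i g\<^sub>j\<^sub>l + \<partial>\<^sub>j g\<^sub>i\<^sub>l - \<partial>\<^sub>l g\<^sub>i\<^sub>j)\<close>.\<close>
definition christoffel ::
    "('a, 'n::finite) tensor \<Rightarrow> ('a, 'n) chart \<Rightarrow> 'a \<Rightarrow> 'n \<Rightarrow> 'n \<Rightarrow> 'n \<Rightarrow> real" where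
  "christoffel g c p k i j = 1/2 * (\<Sum>l\<in>UNIV. inv_metric g c p k l *
     (coord_deriv c i (\<lambda>q. g c q [j, l]) p + coord_deriv c j (\<lambda>q. g c q [i, l]) p
      - coord_deriv c l (\<lambda>q. g c q [i, j]) p))"

text \<open>The new index comes first: \<open>cov_deriv g T c p (i # is)\<close> is \<open>\<nabla>\<^sub>i T\<^sub>i\<^sub>s\<close>, and
  \<open>cov_deriv g (cov_deriv g T) c p (i # j # is)\<close> is \<open>\<nabla>\<^sub>i \<nabla>\<^sub>j T\<^sub>i\<^sub>s\<close>.\<close>
fun cov_deriv :: "('a, 'n::finite) tensor \<Rightarrow> ('a, 'n) tensor \<Rightarrow> ('a, 'n) tensor" where
  "cov_deriv g T c p [] = 0"
| "cov_deriv g T c p (i # is) = coord_deriv c i (\<lambda>q. T c q is) p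
     - (\<Sum>l<length is. \<Sum>m\<in>UNIV. christoffel g c p m i (is ! l) * T c p (is[l := m]))"

text \<open>The components \<open>R(\<partial>\<^sub>i, \<partial>\<^sub>j)\<partial>\<^sub>k = curv\<^sup>l \<partial>\<^sub>l\<close> of
  \<open>R(X, Y)Z = \<nabla>\<^sub>X \<nabla>\<^sub>Y Z - \<nabla>\<^sub>Y \<nabla>\<^sub>X Z - \<nabla>\<^sub>[\<^sub>X\<^sub>,\<^sub>Y\<^sub>] Z\<close>.\<close>
definition curvature_operator ::
    "('a, 'n::finite) tensor \<Rightarrow> ('a, 'n) chart \<Rightarrow> 'a \<Rightarrow> 'n \<Rightarrow> 'n \<Rightarrow> 'n \<Rightarrow> 'n \<Rightarrow> real" where
  "curvature_operator g c p i j k l =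
     coord_deriv c i (\<lambda>q. christoffel g c q l j k) p
     - coord_deriv c j (\<lambda>q. christoffel g c q l i k) p
     + (\<Sum>m\<in>UNIV. christoffel g c p l i m * christoffel g c p m j k
                  - christoffel g c p l j m * christoffel g c p m i k)"

text \<open>Sign convention: \<open>Rm(X, Y, Z, W) = -\<langle>R(X, Y)Z, W\<rangle>\<close>.\<close>
definition riemann ::
    "('a, 'n::finite) tensor \<Rightarrow> ('a, 'n) chart \<Rightarrow> 'a \<Rightarrow> 'n \<Rightarrow> 'n \<Rightarrow> 'n \<Rightarrow> 'n \<Rightarrow> real" where
  "riemann g c p i j k l = - (\<Sum>m\<in>UNIV. curvature_operator g c p i j k m * g c p [m, l])"

text \<open>\<open>R\<^sub>i\<^sub>j = g\<^sup>p\<^sup>q R\<^sub>p\<^sub>i\<^sub>q\<^sub>j\<close>, with \<open>r\<close>, \<open>s\<close> in place of \<open>p\<close>, \<open>q\<close>.\<close>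
definition ricci ::
    "('a, 'n::finite) tensor \<Rightarrow> ('a, 'n) chart \<Rightarrow> 'a \<Rightarrow> 'n \<Rightarrow> 'n \<Rightarrow> real" where
  "ricci g c p i j = (\<Sum>r\<in>UNIV. \<Sum>s\<in>UNIV. inv_metric g c p r s * riemann g c p r i s j)"

section \<open>Gradient Ricci shrinkers\<close>

text \<open>\<open>dm = (4 \<pi> \<tau>)\<^sup>-\<^sup>n\<^sup>/\<^sup>2 e\<^sup>-\<^sup>f dv\<close>\<close>
definition weighted_measure ::
    "'a topology \<Rightarrow> ('a, 'n::finite) chart set \<Rightarrow> ('a, 'n) tensor \<Rightarrow> ('a \<Rightarrow> real) \<Rightarrow> real
      \<Rightarrow> 'a measure" where
  "weighted_measure M A g f \<tau> = density (riemannian_volume M A g)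
     (\<lambda>p. ennreal ((4 * pi * \<tau>) powr (- real CARD('n) / 2) * exp (- f p)))"

definition closed_orientable_gradient_ricci_shrinker ::
    "'a topology \<Rightarrow> ('a, 'n::finite) chart set \<Rightarrow> ('a, 'n) tensor \<Rightarrow> ('a \<Rightarrow> real) \<Rightarrow> real \<Rightarrow> bool"
  where
  "closed_orientable_gradient_ricci_shrinker M A g f \<tau> \<longleftrightarrow>
     smooth_manifold M A \<and> compact_space M \<and> orientable M A \<and>
     riemannian_metric A g \<and> smooth_function A f \<and> \<tau> > 0 \<and>
     (\<forall>c\<in>A. \<forall>p\<in>fst c. \<forall>i j.
        ricci g c p i j + cov_deriv g (cov_deriv g (scalar f)) c p [i, j]
          = 1 / (2 * \<tau>) * g c p [i, j]) \<and>
     emeasure (weighted_measure M A g f \<tau>) (topspace M) = 1"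

section \<open>Weighted differential operators\<close>

definition laplacian :: "('a, 'n::finite) tensor \<Rightarrow> ('a, 'n) tensor \<Rightarrow> ('a, 'n) tensor" where
  "laplacian g T = (\<lambda>c p is.
     \<Sum>r\<in>UNIV. \<Sum>s\<in>UNIV. inv_metric g c p r s * cov_deriv g (cov_deriv g T) c p (r # s # is))"

text \<open>\<open>\<Delta>\<^sub>f = \<Delta> - \<nabla>\<^sub>\<nabla>\<^sub>f\<close> on tensor fields of any rank\<close>
definition weighted_laplacian ::
    "('a, 'n::finite) tensor \<Rightarrow> ('a \<Rightarrow> real) \<Rightarrow> ('a, 'n) tensor \<Rightarrow> ('a, 'n) tensor" where
  "weighted_laplacian g f T = (\<lambda>c p is. laplacian g T c p is
     - (\<Sum>r\<in>UNIV. \<Sum>s\<in>UNIV.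
          inv_metric g c p r s * coord_deriv c r f p * cov_deriv g T c p (s # is)))"

text \<open>The result is a tensor field of rank 0.\<close>
definition weighted_div ::
    "('a, 'n::finite) tensor \<Rightarrow> ('a \<Rightarrow> real) \<Rightarrow> ('a, 'n) tensor \<Rightarrow> ('a, 'n) tensor" where
  "weighted_div g f \<omega> = (\<lambda>c p is.
     \<Sum>r\<in>UNIV. \<Sum>s\<in>UNIV. inv_metric g c p r s *
       (cov_deriv g \<omega> c p [r, s] - \<omega> c p [r] * coord_deriv c s f p))"

text \<open>The vector field \<open>#\<omega>\<close>; vector fields are given by their components \<open>X\<^sup>k\<close> in all charts.\<close>
definition sharp ::
    "('a, 'n::finite) tensor \<Rightarrow> ('a, 'n) tensor \<Rightarrow> ('a, 'n) chart \<Rightarrow> 'a \<Rightarrow> 'n \<Rightarrow> real" where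
  "sharp g \<omega> c p k = (\<Sum>l\<in>UNIV. inv_metric g c p k l * \<omega> c p [l])"

text \<open>The Lie derivative
  \<open>(\<L>\<^sub>X h)(\<partial>\<^sub>i, \<partial>\<^sub>j) = X(h(\<partial>\<^sub>i, \<partial>\<^sub>j)) - h([X, \<partial>\<^sub>i], \<partial>\<^sub>j) - h(\<partial>\<^sub>i, [X, \<partial>\<^sub>j])\<close> of a
  tensor field of rank 2, where \<open>[X, \<partial>\<^sub>i] = - (\<partial>\<^sub>i X\<^sup>k) \<partial>\<^sub>k\<close>.\<close>
definition lie_deriv ::
    "(('a, 'n::finite) chart \<Rightarrow> 'a \<Rightarrow> 'n \<Rightarrow> real) \<Rightarrow> ('a, 'n) tensor \<Rightarrow> ('a, 'n) tensor" where
  "lie_deriv X h = (\<lambda>c p is.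
     \<Sum>k\<in>UNIV. X c p k * coord_deriv c k (\<lambda>q. h c q [is ! 0, is ! 1]) p
       + coord_deriv c (is ! 0) (\<lambda>q. X c q k) p * h c p [k, is ! 1]
       + coord_deriv c (is ! 1) (\<lambda>q. X c q k) p * h c p [is ! 0, k])"

text \<open>\<open>Rm(h, -)\<^sub>i\<^sub>j = R\<^sub>p\<^sub>i\<^sub>q\<^sub>j h\<^sup>p\<^sup>q\<close> with \<open>h\<^sup>p\<^sup>q = g\<^sup>p\<^sup>a g\<^sup>q\<^sup>b h\<^sub>a\<^sub>b\<close>; the summation indices
  \<open>p\<close>, \<open>q\<close> are called \<open>r\<close>, \<open>s\<close> below.\<close>
definition riemann_action :: "('a, 'n::finite) tensor \<Rightarrow> ('a, 'n) tensor \<Rightarrow> ('a, 'n) tensor" where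
  "riemann_action g h = (\<lambda>c p is. \<Sum>r\<in>UNIV. \<Sum>s\<in>UNIV. riemann g c p r (is ! 0) s (is ! 1) *
     (\<Sum>a\<in>UNIV. \<Sum>b\<in>UNIV. inv_metric g c p r a * inv_metric g c p s b * h c p [a, b]))"

definition weighted_lichnerowicz ::
    "('a, 'n::finite) tensor \<Rightarrow> ('a \<Rightarrow> real) \<Rightarrow> real \<Rightarrow> ('a, 'n) tensor \<Rightarrow> ('a, 'n) tensor" where
  "weighted_lichnerowicz g f \<tau> h = (\<lambda>c p is.
     weighted_laplacian g f h c p is + 2 * riemann_action g h c p is - 1 / \<tau> * h c p is)"

end

theory Submission
  imports Defs
begin

text \<open>All three identities are local, so the proof works with components at a point of the domain of one
chart.  The soliton equation reads \<open>Ric + Hess f = \<kappa> g\<close> with \<open>\<kappa> = 1/(2\<tau>)\<close>.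

Christoffel symbols serve to show that \<open>\<nabla>\<close> commutes with metric contractions and with permutations
of the indices, satisfies the Leibniz rule and the Ricci identity (\<open>ricci_identity\<close>), and to compute the
first Bianchi identity and \<open>\<L>\<^sub>#\<^sub>\<omega> g\<close>.  Everything else follows from these rules.  The Ricci identity
for \<open>g\<close> gives the antisymmetry of \<open>Rm\<close> in the last pair of indices; comparing the two ways of
commuting three covariant derivatives of a 1-form gives the second Bianchi identity.

The heart of the matter is that a shrinker satisfies
\<open>\<nabla>\<^sup>r R\<^sub>r\<^sub>i\<^sub>m\<^sub>j = \<nabla>\<^sup>r f R\<^sub>r\<^sub>i\<^sub>m\<^sub>j\<close> (\<open>weighted_div_Rm\<close>).  Indeed, the contracted Bianchi
identity expresses the left-hand side by the skew part of \<open>\<nabla> Ric\<close>, which is minus the skew part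
of \<open>\<nabla> Hess f\<close>, and this is a curvature term by the Ricci identity for \<open>df\<close>.

For a 1-form \<open>\<omega>\<close>, commuting \<open>\<nabla>\<^sub>i\<close> past \<open>\<Delta>\<^sub>f\<close> produces a term in \<open>Ric + Hess f\<close>, which is
a multiple of \<open>\<nabla>\<omega>\<close>, two equal terms in \<open>Rm * \<nabla>\<omega>\<close>, and a term in \<open>\<omega>\<close> itself, whose
coefficient is \<open>\<nabla>\<^sup>r R\<^sub>r\<^sub>i\<^sub>m\<^sub>j - \<nabla>\<^sup>r f R\<^sub>r\<^sub>i\<^sub>m\<^sub>j\<close> and which therefore vanishes
(\<open>cov_deriv_weighted_laplacian_covector\<close>):
\<open>\<nabla>\<^sub>i(\<Delta>\<^sub>f\<omega>)\<^sub>j = (\<Delta>\<^sub>f\<nabla>\<omega>)\<^sub>i\<^sub>j + 2 Rm(\<nabla>\<omega>)\<^sub>i\<^sub>j - \<kappa> \<nabla>\<^sub>i\<omega>\<^sub>j\<close>.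
Its symmetrization is the third claim, because \<open>\<L>\<^sub>#\<^sub>\<omega> g\<close> is twice the symmetric part of \<open>\<nabla>\<omega>\<close>.
Its trace, together with the product rule for \<open>\<Delta>\<^sub>f\<langle>\<omega>, df\<rangle>\<close> and with
\<open>\<Delta>\<^sub>f df = -\<kappa> df\<close> (a trace of \<open>weighted_div_Rm\<close>), is the second claim.  The first claim is the
Bochner formula: commuting \<open>\<nabla>\<^sub>i\<close> past \<open>\<Delta>\<^sub>f\<close> on a function costs exactly
\<open>(Ric + Hess f)(\<nabla>a) = \<kappa> da\<close>.\<close>

section \<open>Smooth functions on open subsets of Euclidean space\<close>

lemma partial_deriv_has_derivative:
  "(F has_derivative F') (at x) \<Longrightarrow> partial_deriv i F x = F' (axis i 1)"
  unfolding partial_deriv_def using frechet_derivative_at by metis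

lemma partial_deriv_cong:
  assumes "open S" "x \<in> S" "\<And>y. y \<in> S \<Longrightarrow> F y = G y"
  shows "partial_deriv i F x = partial_deriv i G x"
proof -
  have "(F has_derivative F') (at x) \<longleftrightarrow> (G has_derivative F') (at x)" for F'
    using has_derivative_transform_within_open[OF _ assms(1,2)] assms(3) by metis
  then show ?thesis
    unfolding partial_deriv_def frechet_derivative_def by simp
qed

lemma Ck_on_cong:
  assumes "open S" "\<And>x. x \<in> S \<Longrightarrow> F x = G x"
  shows "Ck_on k S F \<longleftrightarrow> Ck_on k S G"
  using assms(2)
proof (induction k arbitrary: F G)
  case 0
  then show ?case by (simp cong: continuous_on_cong)
next
  case (Suc k)
  have "F differentiable_on S \<longleftrightarrow> G differentiable_on S"
    unfolding differentiable_on_def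
    using Suc.prems by (metis differentiable_transform_within zero_less_one)
  moreover have "Ck_on k S (partial_deriv i F) \<longleftrightarrow> Ck_on k S (partial_deriv i G)" for i
    using Suc by (intro Suc.IH partial_deriv_cong[OF assms(1)])
  ultimately show ?case by simp
qed

lemma smooth_on_cong:
  "open S \<Longrightarrow> (\<And>x. x \<in> S \<Longrightarrow> F x = G x) \<Longrightarrow> smooth_on S F \<longleftrightarrow> smooth_on S G"
  unfolding smooth_on_def using Ck_on_cong by blast

lemma Ck_on_Suc_imp: "Ck_on (Suc k) S F \<Longrightarrow> Ck_on k S F"
  by (induction k arbitrary: F) (auto simp: differentiable_imp_continuous_on)

lemma smooth_on_imp_differentiable:
  "smooth_on S F \<Longrightarrow> F differentiable_on S"
  unfolding smooth_on_def by (metis Ck_on.simps(2))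

lemma smooth_on_imp_differentiable_at:
  "smooth_on S F \<Longrightarrow> open S \<Longrightarrow> x \<in> S \<Longrightarrow> F differentiable (at x)"
  using smooth_on_imp_differentiable differentiable_on_eq_differentiable_at by blast

lemma smooth_on_partial_deriv: "smooth_on S F \<Longrightarrow> smooth_on S (partial_deriv i F)"
  unfolding smooth_on_def by (metis Ck_on.simps(2))

lemma smooth_on_imp_continuous_on: "smooth_on S F \<Longrightarrow> continuous_on S F"
  unfolding smooth_on_def by (metis Ck_on.simps(1))

lemma smooth_on_const: "smooth_on S (\<lambda>x. b)"
proof -
  have "Ck_on k S (\<lambda>x::real^'a. b)" for k b
  proof (induction k arbitrary: b)
    case (Suc k)
    have "partial_deriv i (\<lambda>x::real^'a. b) = (\<lambda>x. 0)" for i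
      by (auto simp: partial_deriv_def)
    then show ?case using Suc by simp
  qed simp
  then show ?thesis by (simp add: smooth_on_def)
qed

lemma partial_deriv_add:
  assumes "F differentiable at x" "G differentiable at x"
  shows "partial_deriv i (\<lambda>x. F x + G x) x = partial_deriv i F x + partial_deriv i G x"
  by (subst partial_deriv_has_derivative[OF has_derivative_add[OF assms[unfolded frechet_derivative_works]]])
    (simp add: partial_deriv_def)

lemma partial_deriv_mult:
  assumes "F differentiable at x" "G differentiable at x"
  shows "partial_deriv i (\<lambda>x. F x * G x) x = F x * partial_deriv i G x + partial_deriv i F x * G x"
  by (subst partial_deriv_has_derivative[OF has_derivative_mult[OF assms[unfolded frechet_derivative_works]]])
    (simp add: partial_deriv_def)

lemma partial_deriv_inverse:
  assumes "F differentiable at x" "F x \<noteq> 0"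
  shows "partial_deriv i (\<lambda>x. inverse (F x)) x = - (inverse (F x) * partial_deriv i F x * inverse (F x))"
  by (subst partial_deriv_has_derivative[OF Deriv.has_derivative_inverse[OF assms(2)
        assms(1)[unfolded frechet_derivative_works]]])
    (simp add: partial_deriv_def)

lemma Ck_on_add:
  assumes "open S" "Ck_on k S F" "Ck_on k S G"
  shows "Ck_on k S (\<lambda>x. F x + G x)"
  using assms(2,3)
proof (induction k arbitrary: F G)
  case (Suc k)
  have "Ck_on k S (partial_deriv i (\<lambda>x. F x + G x))" for i
  proof (subst Ck_on_cong[OF assms(1)])
    show "partial_deriv i (\<lambda>x. F x + G x) x = partial_deriv i F x + partial_deriv i G x" if "x \<in> S" for x
      using Suc.prems that assms(1) by (intro partial_deriv_add) (auto simp: differentiable_on_eq_differentiable_at)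
  qed (use Suc in auto)
  then show ?case using Suc.prems by auto
qed (auto intro: continuous_intros)

lemma Ck_on_mult:
  assumes "open S" "Ck_on k S F" "Ck_on k S G"
  shows "Ck_on k S (\<lambda>x. F x * G x)"
  using assms(2,3)
proof (induction k arbitrary: F G)
  case (Suc k)
  have "Ck_on k S (partial_deriv i (\<lambda>x. F x * G x))" for i
  proof (subst Ck_on_cong[OF assms(1)])
    show "partial_deriv i (\<lambda>x. F x * G x) x = F x * partial_deriv i G x + partial_deriv i F x * G x"
      if "x \<in> S" for x
      using Suc.prems that assms(1) by (intro partial_deriv_mult) (auto simp: differentiable_on_eq_differentiable_at)
    show "Ck_on k S (\<lambda>x. F x * partial_deriv i G x + partial_deriv i F x * G x)"
      using Suc.prems Ck_on_Suc_imp[of k S F] Ck_on_Suc_imp[of k S G]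
      by (intro Ck_on_add assms(1) Suc.IH) auto
  qed
  then show ?case using Suc.prems by auto
qed (auto intro: continuous_intros)

lemma Ck_on_inverse:
  assumes "open S" "Ck_on k S F" "\<And>x. x \<in> S \<Longrightarrow> F x \<noteq> 0"
  shows "Ck_on k S (\<lambda>x. inverse (F x))"
  using assms(2)
proof (induction k)
  case 0
  then show ?case using assms(3) by (auto intro: continuous_intros)
next
  case (Suc k)
  have IH: "Ck_on k S (\<lambda>x. inverse (F x))"
    using Suc Ck_on_Suc_imp by blast
  have "Ck_on k S (partial_deriv i (\<lambda>x. inverse (F x)))" for i
  proof (subst Ck_on_cong[OF assms(1)])
    show "partial_deriv i (\<lambda>x. inverse (F x)) x = (-1) * (inverse (F x) * partial_deriv i F x * inverse (F x))"
      if "x \<in> S" for x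
      using Suc.prems that assms(1,3)
      by (subst partial_deriv_inverse) (auto simp: differentiable_on_eq_differentiable_at)
    show "Ck_on k S (\<lambda>x. - 1 * (inverse (F x) * partial_deriv i F x * inverse (F x)))"
      using Suc.prems smooth_on_const[of S "-1"] IH unfolding smooth_on_def
      by (intro Ck_on_mult assms(1)) auto
  qed
  moreover have "(\<lambda>x. inverse (F x)) differentiable_on S"
    using Suc.prems assms(3) by (auto simp: differentiable_on_def)
  ultimately show ?case by auto
qed

lemma smooth_on_add: "open S \<Longrightarrow> smooth_on S F \<Longrightarrow> smooth_on S G \<Longrightarrow> smooth_on S (\<lambda>x. F x + G x)"
  by (simp add: smooth_on_def Ck_on_add)

lemma smooth_on_mult: "open S \<Longrightarrow> smooth_on S F \<Longrightarrow> smooth_on S G \<Longrightarrow> smooth_on S (\<lambda>x. F x * G x)"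
  by (simp add: smooth_on_def Ck_on_mult)

lemma smooth_on_inverse:
  "open S \<Longrightarrow> smooth_on S F \<Longrightarrow> (\<And>x. x \<in> S \<Longrightarrow> F x \<noteq> 0) \<Longrightarrow> smooth_on S (\<lambda>x. inverse (F x))"
  by (simp add: smooth_on_def Ck_on_inverse)

lemma has_real_derivative_along_axis:
  assumes "F differentiable at (y + s *\<^sub>R axis i 1)"
  shows "((\<lambda>s. F (y + s *\<^sub>R axis i 1)) has_real_derivative partial_deriv i F (y + s *\<^sub>R axis i 1)) (at s)"
proof -
  have lin: "linear (frechet_derivative F (at (y + s *\<^sub>R axis i 1)))"
    using assms linear_frechet_derivative by blast
  have "((\<lambda>s. y + s *\<^sub>R axis i 1) has_derivative (\<lambda>h. h *\<^sub>R axis i 1)) (at s)"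
    by (auto intro!: derivative_eq_intros)
  from diff_chain_at[OF this assms[unfolded frechet_derivative_works]]
  have "((\<lambda>s. F (y + s *\<^sub>R axis i 1)) has_derivative
      (\<lambda>h. h * partial_deriv i F (y + s *\<^sub>R axis i 1))) (at s)"
    by (simp add: o_def partial_deriv_def linear_scale[OF lin])
  then show ?thesis
    by (simp add: has_field_derivative_def mult_commute_abs)
qed

text \<open>The mean value theorem is applied twice: to the difference in direction \<open>j\<close> as a function of the
step in direction \<open>i\<close>, and then to the resulting difference of \<open>i\<close>-th derivatives.  The
left-hand side is symmetric in \<open>i\<close> and \<open>j\<close>, which is what makes partial derivatives commute.\<close>
lemma second_difference_eq_mixed_partial:
  fixes x :: "real^'n::finite"
  assumes "ball x r \<subseteq> S" "open S" "smooth_on S F" "0 < h" "2 * h < r"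
  shows "\<exists>y. dist x y < 2 * h \<and>
    F (x + h *\<^sub>R axis i 1 + h *\<^sub>R axis j 1) - F (x + h *\<^sub>R axis i 1) - F (x + h *\<^sub>R axis j 1) + F x
      = h * h * partial_deriv j (partial_deriv i F) y"
proof -
  let ?e = "axis i 1 :: real^'n" and ?d = "axis j 1 :: real^'n"
  have near: "dist x (x + s *\<^sub>R ?e + t *\<^sub>R ?d) \<le> \<bar>s\<bar> + \<bar>t\<bar>" for s t
  proof -
    have "dist x (x + s *\<^sub>R ?e + t *\<^sub>R ?d) = norm (s *\<^sub>R ?e + t *\<^sub>R ?d)"
      by (metis add.assoc add_diff_cancel_left' dist_commute dist_norm)
    also have "\<dots> \<le> \<bar>s\<bar> + \<bar>t\<bar>"
      using norm_triangle_ineq[of "s *\<^sub>R ?e" "t *\<^sub>R ?d"] by (simp add: norm_axis_1)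
    finally show ?thesis .
  qed
  have inS: "x + s *\<^sub>R ?e + t *\<^sub>R ?d \<in> S" if "0 \<le> s" "s \<le> h" "0 \<le> t" "t \<le> h" for s t
    using near[of s t] that assms(1,5) by (auto simp: subset_iff)
  have dF: "F differentiable at z" "partial_deriv i F differentiable at z" if "z \<in> S" for z
    using assms(2,3) that smooth_on_imp_differentiable_at smooth_on_partial_deriv by blast+
  define \<phi> where "\<phi> = (\<lambda>s. F (x + h *\<^sub>R ?d + s *\<^sub>R ?e) - F (x + s *\<^sub>R ?e))"
  have "\<exists>s. 0 < s \<and> s < h \<and> \<phi> h - \<phi> 0 = (h - 0) *
      (partial_deriv i F (x + h *\<^sub>R ?d + s *\<^sub>R ?e) - partial_deriv i F (x + s *\<^sub>R ?e))"
    unfolding \<phi>_def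
  proof (rule MVT2[OF assms(4)])
    fix s assume s: "0 \<le> s" "s \<le> h"
    show "((\<lambda>s. F (x + h *\<^sub>R ?d + s *\<^sub>R ?e) - F (x + s *\<^sub>R ?e)) has_real_derivative
        partial_deriv i F (x + h *\<^sub>R ?d + s *\<^sub>R ?e) - partial_deriv i F (x + s *\<^sub>R ?e)) (at s)"
      using inS[of s h] inS[of s 0] s assms(4)
      by (intro DERIV_diff has_real_derivative_along_axis dF(1)) (auto simp: algebra_simps)
  qed
  then obtain s where s: "0 < s" "s < h" and \<phi>: "\<phi> h - \<phi> 0 = h *
      (partial_deriv i F (x + h *\<^sub>R ?d + s *\<^sub>R ?e) - partial_deriv i F (x + s *\<^sub>R ?e))"
    by auto
  have "\<exists>t. 0 < t \<and> t < h \<and>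
      partial_deriv i F (x + s *\<^sub>R ?e + h *\<^sub>R ?d) - partial_deriv i F (x + s *\<^sub>R ?e + 0 *\<^sub>R ?d)
        = (h - 0) * partial_deriv j (partial_deriv i F) (x + s *\<^sub>R ?e + t *\<^sub>R ?d)"
    using inS s by (intro MVT2[OF assms(4)] has_real_derivative_along_axis dF(2)) auto
  then obtain t where t: "0 < t" "t < h" and
      "partial_deriv i F (x + s *\<^sub>R ?e + h *\<^sub>R ?d) - partial_deriv i F (x + s *\<^sub>R ?e)
        = h * partial_deriv j (partial_deriv i F) (x + s *\<^sub>R ?e + t *\<^sub>R ?d)"
    by auto
  with \<phi> have "\<phi> h - \<phi> 0 = h * h * partial_deriv j (partial_deriv i F) (x + s *\<^sub>R ?e + t *\<^sub>R ?d)"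
    by (simp add: ac_simps)
  moreover have "dist x (x + s *\<^sub>R ?e + t *\<^sub>R ?d) < 2 * h"
    using near[of s t] s t by linarith
  ultimately show ?thesis
    unfolding \<phi>_def by (intro exI[of _ "x + s *\<^sub>R ?e + t *\<^sub>R ?d"]) (auto simp: ac_simps)
qed

text \<open>At points arbitrarily close to \<open>x\<close>, both mixed derivatives take the value of the same second
difference quotient, so by continuity they agree at \<open>x\<close>.\<close>
lemma partial_deriv_commute:
  fixes x :: "real^'n::finite"
  assumes "open S" "smooth_on S F" "x \<in> S"
  shows "partial_deriv i (partial_deriv j F) x = partial_deriv j (partial_deriv i F) x"
proof (rule ccontr)
  let ?A = "partial_deriv i (partial_deriv j F)" and ?B = "partial_deriv j (partial_deriv i F)"
  assume ne: "?A x \<noteq> ?B x"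
  define e where "e = \<bar>?A x - ?B x\<bar> / 2"
  have e: "e > 0" using ne by (simp add: e_def)
  have "isCont ?A x" "isCont ?B x"
    using assms smooth_on_imp_continuous_on[OF smooth_on_partial_deriv[OF smooth_on_partial_deriv]]
    by (metis continuous_on_eq_continuous_at)+
  then obtain d1 d2 where d: "d1 > 0" "d2 > 0" "\<And>y. dist y x < d1 \<Longrightarrow> dist (?A y) (?A x) < e"
      "\<And>y. dist y x < d2 \<Longrightarrow> dist (?B y) (?B x) < e"
    unfolding continuous_at_eps_delta using e by metis
  obtain r where r: "r > 0" "ball x r \<subseteq> S" using assms openE by blast
  define h where "h = Min {d1, d2, r} / 3"
  have h: "h > 0" "2 * h < d1" "2 * h < d2" "2 * h < r"
    using d r by (auto simp: h_def min_def)
  obtain y where y: "dist x y < 2 * h" "F (x + h *\<^sub>R axis i 1 + h *\<^sub>R axis j 1) - F (x + h *\<^sub>R axis i 1)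
      - F (x + h *\<^sub>R axis j 1) + F x = h * h * ?B y"
    using second_difference_eq_mixed_partial[OF r(2) assms(1,2) h(1,4)] by blast
  obtain z where z: "dist x z < 2 * h" "F (x + h *\<^sub>R axis j 1 + h *\<^sub>R axis i 1) - F (x + h *\<^sub>R axis j 1)
      - F (x + h *\<^sub>R axis i 1) + F x = h * h * ?A z"
    using second_difference_eq_mixed_partial[OF r(2) assms(1,2) h(1,4)] by blast
  have "h * h * ?B y = h * h * ?A z" using y(2) z(2) by (simp add: algebra_simps)
  then have "?B y = ?A z" using h by simp
  moreover have "dist (?A z) (?A x) < e" "dist (?B y) (?B x) < e"
    using d(3)[of z] d(4)[of y] h(2,3) y(1) z(1) by (simp_all add: dist_commute)
  ultimately show False unfolding e_def dist_real_def by argo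
qed

section \<open>Calculus in a coordinate chart\<close>

locale coordinate_chart =
  fixes c :: "('a, 'n::finite) chart"
  assumes inj: "inj_on (snd c) (fst c)"
    and open_image: "open (snd c ` fst c)"
begin

abbreviation "chart_dom \<equiv> fst c"

definition smooth :: "('a \<Rightarrow> real) \<Rightarrow> bool" where
  "smooth F \<longleftrightarrow> smooth_on (snd c ` chart_dom) (\<lambda>x. F (chart_inv c x))"

abbreviation pd :: "'n \<Rightarrow> ('a \<Rightarrow> real) \<Rightarrow> 'a \<Rightarrow> real" where
  "pd \<equiv> coord_deriv c"

lemma chart_inv_snd [simp]: "p \<in> chart_dom \<Longrightarrow> chart_inv c (snd c p) = p"
  by (simp add: chart_inv_def inj)

lemma smooth_cong: "(\<And>p. p \<in> chart_dom \<Longrightarrow> F p = G p) \<Longrightarrow> smooth F \<longleftrightarrow> smooth G"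
  unfolding smooth_def by (intro smooth_on_cong open_image) auto

lemma smooth_const [intro]: "smooth (\<lambda>p. b)"
  by (simp add: smooth_def smooth_on_const)

lemma smooth_add [intro]: "smooth F \<Longrightarrow> smooth G \<Longrightarrow> smooth (\<lambda>p. F p + G p)"
  unfolding smooth_def by (intro smooth_on_add open_image)

lemma smooth_mult [intro]: "smooth F \<Longrightarrow> smooth G \<Longrightarrow> smooth (\<lambda>p. F p * G p)"
  unfolding smooth_def by (intro smooth_on_mult open_image)

lemma smooth_minus [intro]: "smooth F \<Longrightarrow> smooth (\<lambda>p. - F p)"
  using smooth_mult[of "\<lambda>p. -1" F] by auto

lemma smooth_diff [intro]: "smooth F \<Longrightarrow> smooth G \<Longrightarrow> smooth (\<lambda>p. F p - G p)"
  using smooth_add[of F "\<lambda>p. - G p"] by auto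

lemma smooth_sum [intro]: "(\<And>k. k \<in> K \<Longrightarrow> smooth (F k)) \<Longrightarrow> smooth (\<lambda>p. \<Sum>k\<in>K. F k p)"
  by (induction K rule: infinite_finite_induct) auto

lemma smooth_prod [intro]: "(\<And>k. k \<in> K \<Longrightarrow> smooth (F k)) \<Longrightarrow> smooth (\<lambda>p. \<Prod>k\<in>K. F k p)"
  by (induction K rule: infinite_finite_induct) auto

lemma smooth_divide:
  assumes "smooth F" "smooth G" "\<And>p. p \<in> chart_dom \<Longrightarrow> G p \<noteq> 0"
  shows "smooth (\<lambda>p. F p / G p)"
proof -
  have "smooth (\<lambda>p. inverse (G p))"
    using assms unfolding smooth_def by (intro smooth_on_inverse open_image) auto
  then show ?thesis using smooth_mult[OF assms(1)] by (simp add: divide_inverse)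
qed

lemma smooth_coord_deriv [intro]: "smooth F \<Longrightarrow> smooth (pd i F)"
  unfolding smooth_def
  by (subst smooth_on_cong[OF open_image, of _ "partial_deriv i (\<lambda>x. F (chart_inv c x))"])
    (auto simp: coord_deriv_def intro: smooth_on_partial_deriv)

lemma coord_deriv_cong:
  assumes "p \<in> chart_dom" "\<And>q. q \<in> chart_dom \<Longrightarrow> F q = G q"
  shows "pd i F p = pd i G p"
  unfolding coord_deriv_def using assms
  by (intro partial_deriv_cong[OF open_image]) auto

lemma smooth_differentiable:
  "smooth F \<Longrightarrow> p \<in> chart_dom \<Longrightarrow> (\<lambda>x. F (chart_inv c x)) differentiable at (snd c p)"
  unfolding smooth_def by (intro smooth_on_imp_differentiable_at[OF _ open_image]) auto

lemma coord_deriv_const [simp]: "pd i (\<lambda>q. b) p = 0"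
  by (simp add: coord_deriv_def partial_deriv_def)

lemma coord_deriv_add:
  "smooth F \<Longrightarrow> smooth G \<Longrightarrow> p \<in> chart_dom \<Longrightarrow> pd i (\<lambda>q. F q + G q) p = pd i F p + pd i G p"
  unfolding coord_deriv_def by (intro partial_deriv_add smooth_differentiable)

lemma coord_deriv_mult:
  "smooth F \<Longrightarrow> smooth G \<Longrightarrow> p \<in> chart_dom \<Longrightarrow> pd i (\<lambda>q. F q * G q) p = F p * pd i G p + pd i F p * G p"
  unfolding coord_deriv_def by (subst partial_deriv_mult) (auto intro: smooth_differentiable)

lemma coord_deriv_cmult:
  "smooth F \<Longrightarrow> p \<in> chart_dom \<Longrightarrow> pd i (\<lambda>q. b * F q) p = b * pd i F p"
  using coord_deriv_mult[of "\<lambda>q. b" F] by auto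

lemma coord_deriv_diff:
  assumes "smooth F" "smooth G" "p \<in> chart_dom"
  shows "pd i (\<lambda>q. F q - G q) p = pd i F p - pd i G p"
  using coord_deriv_add[OF assms(1) smooth_minus[OF assms(2)] assms(3), of i]
    coord_deriv_cmult[OF assms(2,3), of i "-1"] by simp

lemma coord_deriv_sum:
  assumes "\<And>k. k \<in> K \<Longrightarrow> smooth (F k)" "p \<in> chart_dom"
  shows "pd i (\<lambda>q. \<Sum>k\<in>K. F k q) p = (\<Sum>k\<in>K. pd i (F k) p)"
  using assms(1)
  by (induction K rule: infinite_finite_induct) (auto simp: coord_deriv_add assms(2) smooth_sum)

lemma coord_deriv_commute:
  assumes "smooth F" "p \<in> chart_dom"
  shows "pd i (pd j F) p = pd j (pd i F) p"
proof -
  have "pd i (pd j F) p = partial_deriv i (partial_deriv j (\<lambda>x. F (chart_inv c x))) (snd c p)" for i j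
    unfolding coord_deriv_def[of c i] using assms(2)
    by (intro partial_deriv_cong[OF open_image]) (auto simp: coord_deriv_def)
  then show ?thesis
    using partial_deriv_commute[OF open_image] assms unfolding smooth_def by auto
qed

end

section \<open>Matrices acting on components as derivations\<close>

text \<open>The derivation of the tensor algebra induced by a matrix \<open>N\<close>: it acts on one index at a time.  The
Christoffel symbols \<open>\<Gamma>\<^sup>m\<^sub>i\<^sub>k\<close> and the curvature operator \<open>R(\<partial>\<^sub>i, \<partial>\<^sub>j)\<close>, for fixed \<open>i\<close> and
\<open>j\<close>, enter covariant derivatives and their commutators only through this action.\<close>
definition endomorphism_action :: "('n \<Rightarrow> 'n \<Rightarrow> real) \<Rightarrow> ('n list \<Rightarrow> real) \<Rightarrow> 'n::finite list \<Rightarrow> real" where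
  "endomorphism_action N T is = (\<Sum>l<length is. \<Sum>m\<in>UNIV. N m (is ! l) * T (is[l := m]))"

lemma endomorphism_action_Nil [simp]: "endomorphism_action N T [] = 0"
  by (simp add: endomorphism_action_def)

lemma endomorphism_action_Cons [simp]:
  "endomorphism_action N T (k # is) =
     (\<Sum>m\<in>UNIV. N m k * T (m # is)) + endomorphism_action N (\<lambda>js. T (k # js)) is"
  by (simp add: endomorphism_action_def sum.lessThan_Suc_shift del: sum.lessThan_Suc)

lemma endomorphism_action_cong:
  "(\<And>js. length js = length is \<Longrightarrow> T js = U js) \<Longrightarrow>
    endomorphism_action N T is = endomorphism_action N U is"
  by (auto simp: endomorphism_action_def intro!: sum.cong)

lemma endomorphism_action_add:
  "endomorphism_action N (\<lambda>js. T js + U js) is = endomorphism_action N T is + endomorphism_action N U is"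
  by (simp add: endomorphism_action_def sum.distrib distrib_left)

lemma endomorphism_action_diff:
  "endomorphism_action N (\<lambda>js. T js - U js) is = endomorphism_action N T is - endomorphism_action N U is"
  by (simp add: endomorphism_action_def sum_subtractf right_diff_distrib)

lemma endomorphism_action_cmult:
  "endomorphism_action N (\<lambda>js. b * T js) is = b * endomorphism_action N T is"
  by (simp add: endomorphism_action_def sum_distrib_left ac_simps)

lemma endomorphism_action_sum:
  "endomorphism_action N (\<lambda>js. \<Sum>k\<in>K. T k js) is = (\<Sum>k\<in>K. endomorphism_action N (T k) is)"
proof (induction K rule: infinite_finite_induct)
  case (insert k K)
  then show ?case by (simp add: endomorphism_action_add)
qed (simp_all add: endomorphism_action_def)

lemma endomorphism_action_diff_left:
  "endomorphism_action (\<lambda>m k. N m k - N' m k) T is = endomorphism_action N T is - endomorphism_action N' T is"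
  by (simp add: endomorphism_action_def sum_subtractf left_diff_distrib)

lemma endomorphism_action_add_left:
  "endomorphism_action (\<lambda>m k. N m k + N' m k) T is = endomorphism_action N T is + endomorphism_action N' T is"
  by (simp add: endomorphism_action_def sum.distrib distrib_right)

text \<open>The action is an antihomomorphism of Lie algebras: terms in which \<open>N\<close> and \<open>N'\<close> act on different
indices cancel.  This produces the quadratic part of the curvature in the Ricci identity for tensors of
every rank at once.\<close>
lemma endomorphism_action_commutator:
  "endomorphism_action N (endomorphism_action N' T) is - endomorphism_action N' (endomorphism_action N T) is =
     endomorphism_action (\<lambda>n k. \<Sum>m\<in>UNIV. N' n m * N m k - N n m * N' m k) T is"
proof (induction "is" arbitrary: T)
  case (Cons k "is")
  have expand: "endomorphism_action N (endomorphism_action N' T) (k # is) =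
      (\<Sum>n\<in>UNIV. (\<Sum>m\<in>UNIV. N' n m * N m k) * T (n # is))
      + (\<Sum>m\<in>UNIV. N m k * endomorphism_action N' (\<lambda>js. T (m # js)) is)
      + (\<Sum>m\<in>UNIV. N' m k * endomorphism_action N (\<lambda>js. T (m # js)) is)
      + endomorphism_action N (endomorphism_action N' (\<lambda>js. T (k # js))) is" for N N'
  proof -
    have "(\<Sum>m\<in>UNIV. N m k * (\<Sum>n\<in>UNIV. N' n m * T (n # is))) =
        (\<Sum>n\<in>UNIV. (\<Sum>m\<in>UNIV. N' n m * N m k) * T (n # is))"
      unfolding sum_distrib_left sum_distrib_right
      by (subst sum.swap) (simp add: ac_simps)
    then show ?thesis
      by (simp add: endomorphism_action_add endomorphism_action_sum endomorphism_action_cmult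
          distrib_left sum.distrib)
  qed
  show ?case
    unfolding expand[of N N'] expand[of N' N]
    using Cons.IH[of "\<lambda>js. T (k # js)"]
    by (simp add: sum_subtractf left_diff_distrib)
qed simp

text \<open>A derivation treats all indices alike.  The list \<open>\<pi>\<close> is a permutation of the index positions.\<close>
lemma endomorphism_action_permute:
  assumes \<pi>: "distinct \<pi>" "set \<pi> = {..<length is}"
  shows "endomorphism_action N (\<lambda>js. T (map ((!) js) \<pi>)) is = endomorphism_action N T (map ((!) is) \<pi>)"
proof -
  have bij: "bij_betw ((!) \<pi>) {..<length \<pi>} {..<length is}"
    by (intro bij_betw_nth \<pi>(1) refl) (simp add: \<pi>(2))
  have upd: "map ((!) (is[\<pi> ! l := m])) \<pi> = (map ((!) is) \<pi>)[l := m]" if "l < length \<pi>" for l m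
  proof (rule nth_equalityI)
    fix l' assume l': "l' < length (map ((!) (is[\<pi> ! l := m])) \<pi>)"
    then have "\<pi> ! l = \<pi> ! l' \<longleftrightarrow> l = l'" "\<pi> ! l < length is"
      using \<pi> that by (auto simp: nth_eq_iff_index_eq set_conv_nth)
    then show "map ((!) (is[\<pi> ! l := m])) \<pi> ! l' = (map ((!) is) \<pi>)[l := m] ! l'"
      using l' by (auto simp: nth_list_update)
  qed simp
  show ?thesis
    unfolding endomorphism_action_def
    by (subst sum.reindex_bij_betw[OF bij, symmetric]) (simp add: upd)
qed

lemma cov_deriv_Cons:
  "cov_deriv g T c p (i # is) = coord_deriv c i (\<lambda>q. T c q is) p
     - endomorphism_action (\<lambda>m k. christoffel g c p m i k) (T c p) is"
  by (simp add: endomorphism_action_def)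

section \<open>The metric in a coordinate chart\<close>

lemma sum_kronecker:
  fixes X :: "'n::finite \<Rightarrow> real"
  shows "(\<Sum>u\<in>UNIV. (if r = u then 1 else 0) * X u) = X r"
    and "(\<Sum>u\<in>UNIV. X u * (if r = u then 1 else 0)) = X r"
    and "(\<Sum>u\<in>UNIV. (if u = r then 1 else 0) * X u) = X r"
    and "(\<Sum>u\<in>UNIV. X u * (if u = r then 1 else 0)) = X r"
  by (simp_all add: if_distrib if_distribR cong: if_cong)

declare cov_deriv.simps [simp del]

context coordinate_chart
begin

definition smooth_tensor :: "nat \<Rightarrow> ('a, 'n) tensor \<Rightarrow> bool" where
  "smooth_tensor k T \<longleftrightarrow> (\<forall>is. length is = k \<longrightarrow> smooth (\<lambda>p. T c p is))"

lemma smooth_tensorD: "smooth_tensor k T \<Longrightarrow> length is = k \<Longrightarrow> smooth (\<lambda>p. T c p is)"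
  by (simp add: smooth_tensor_def)

end

locale riemannian_chart = coordinate_chart c
  for c :: "('a, 'n::finite) chart" +
  fixes g :: "('a, 'n) tensor"
  assumes metric_smooth: "smooth (\<lambda>p. g c p [i, j])"
    and metric_sym: "p \<in> chart_dom \<Longrightarrow> g c p [i, j] = g c p [j, i]"
    and metric_pos: "p \<in> chart_dom \<Longrightarrow> v \<noteq> 0 \<Longrightarrow>
      (\<Sum>i\<in>UNIV. \<Sum>j\<in>UNIV. g c p [i, j] * v $ i * v $ j) > 0"
begin

abbreviation \<Gamma> where "\<Gamma> p \<equiv> christoffel g c p"
abbreviation ginv where "ginv p \<equiv> inv_metric g c p"
abbreviation nabla where "nabla \<equiv> cov_deriv g"

lemma metric_invertible:
  assumes "p \<in> chart_dom"
  shows "invertible (metric_matrix g c p)"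
proof -
  have "v = 0" if "metric_matrix g c p *v v = 0" for v
  proof (rule ccontr)
    assume "v \<noteq> 0"
    have "(\<Sum>i\<in>UNIV. \<Sum>j\<in>UNIV. g c p [i, j] * v $ i * v $ j)
        = (\<Sum>i\<in>UNIV. v $ i * (metric_matrix g c p *v v) $ i)"
      by (simp add: metric_matrix_def matrix_vector_mult_def sum_distrib_left ac_simps)
    also have "\<dots> = 0" by (simp add: that)
    finally show False using metric_pos[OF assms \<open>v \<noteq> 0\<close>] by simp
  qed
  then show ?thesis
    by (simp add: matrix_left_invertible_ker invertible_left_inverse)
qed

lemma metric_matrix_nth: "metric_matrix g c p $ i $ j = g c p [i, j]"
  by (simp add: metric_matrix_def)

lemma matrix_inv_metric:
  assumes "p \<in> chart_dom"
  shows "metric_matrix g c p ** matrix_inv (metric_matrix g c p) = mat 1"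
    and "matrix_inv (metric_matrix g c p) ** metric_matrix g c p = mat 1"
  using someI_ex[OF metric_invertible[OF assms, unfolded invertible_def]]
  by (simp_all add: matrix_inv_def)

lemma inv_metric_left:
  assumes "p \<in> chart_dom"
  shows "(\<Sum>s\<in>UNIV. ginv p r s * g c p [s, t]) = (if r = t then 1 else 0)"
proof -
  have "(matrix_inv (metric_matrix g c p) ** metric_matrix g c p) $ r $ t = mat 1 $ r $ t"
    by (simp add: matrix_inv_metric[OF assms])
  then show ?thesis
    by (simp add: matrix_matrix_mult_def mat_def inv_metric_def metric_matrix_def)
qed

lemma inv_metric_right:
  assumes "p \<in> chart_dom"
  shows "(\<Sum>s\<in>UNIV. g c p [r, s] * ginv p s t) = (if r = t then 1 else 0)"
proof -
  have "(metric_matrix g c p ** matrix_inv (metric_matrix g c p)) $ r $ t = mat 1 $ r $ t"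
    by (simp add: matrix_inv_metric[OF assms])
  then show ?thesis
    by (simp add: matrix_matrix_mult_def mat_def inv_metric_def metric_matrix_def)
qed

lemma inv_metric_sym:
  assumes "p \<in> chart_dom"
  shows "ginv p r s = ginv p s r"
proof -
  have "ginv p r s = (\<Sum>t\<in>UNIV. ginv p r t * (\<Sum>u\<in>UNIV. g c p [u, t] * ginv p s u))"
    by (simp add: mult.commute[of "g c p _"] inv_metric_left[OF assms] sum_kronecker)
  also have "\<dots> = (\<Sum>u\<in>UNIV. (\<Sum>t\<in>UNIV. ginv p r t * g c p [t, u]) * ginv p s u)"
    unfolding sum_distrib_left sum_distrib_right
    by (subst sum.swap) (simp add: ac_simps metric_sym[OF assms])
  also have "\<dots> = ginv p s r"
    by (simp add: inv_metric_left[OF assms] sum_kronecker)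
  finally show ?thesis .
qed

text \<open>Keeping double sums inside \<open>contract\<close>, and moving them
only with \<open>contract_contract\<close> and \<open>contract_commute\<close>, makes the index computations below resemble those
with raised indices.\<close>
definition contract :: "'a \<Rightarrow> ('n \<Rightarrow> 'n \<Rightarrow> real) \<Rightarrow> real" where
  "contract p X = (\<Sum>r\<in>UNIV. \<Sum>s\<in>UNIV. ginv p r s * X r s)"

lemma contract_add: "contract p (\<lambda>r s. X r s + Y r s) = contract p X + contract p Y"
  by (simp add: contract_def distrib_left sum.distrib)

lemma contract_diff: "contract p (\<lambda>r s. X r s - Y r s) = contract p X - contract p Y"
  by (simp add: contract_def right_diff_distrib sum_subtractf)

lemma contract_minus: "contract p (\<lambda>r s. - X r s) = - contract p X"
  by (simp add: contract_def sum_negf)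

lemma contract_cmult: "contract p (\<lambda>r s. x * X r s) = x * contract p X"
  unfolding contract_def sum_distrib_left by (intro sum.cong refl) simp

lemma contract_cmult_right: "contract p (\<lambda>r s. X r s * x) = contract p X * x"
  unfolding contract_def sum_distrib_right by (intro sum.cong refl) simp

lemma contract_commute:
  "p \<in> chart_dom \<Longrightarrow> contract p X = contract p (\<lambda>r s. X s r)"
  unfolding contract_def by (subst sum.swap) (simp add: inv_metric_sym)

lemma contract_contract:
  "contract p (\<lambda>r s. contract p (X r s)) = contract p (\<lambda>m q. contract p (\<lambda>r s. X r s m q))"
proof -
  have pairs: "contract p Y = (\<Sum>u\<in>UNIV. ginv p (fst u) (snd u) * Y (fst u) (snd u))" for Y
    by (simp add: contract_def sum.cartesian_product case_prod_beta)
  show ?thesis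
    unfolding pairs sum_distrib_left
    by (subst sum.swap) (intro sum.cong refl, simp)
qed

lemma contract_metric:
  assumes "p \<in> chart_dom"
  shows "contract p (\<lambda>r s. v r * g c p [s, l]) = v l"
    and "contract p (\<lambda>r s. g c p [l, r] * v s) = v l"
proof -
  have "contract p (\<lambda>r s. v r * g c p [s, l]) = (\<Sum>r\<in>UNIV. v r * (\<Sum>s\<in>UNIV. ginv p r s * g c p [s, l]))"
    by (simp add: contract_def sum_distrib_left ac_simps)
  then show *: "contract p (\<lambda>r s. v r * g c p [s, l]) = v l"
    by (simp add: inv_metric_left[OF assms] sum_kronecker)
  have "contract p (\<lambda>r s. g c p [l, r] * v s) = contract p (\<lambda>r s. g c p [l, s] * v r)"
    by (rule contract_commute[OF assms])
  with * show "contract p (\<lambda>r s. g c p [l, r] * v s) = v l"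
    by (simp add: metric_sym[OF assms, of l] ac_simps)
qed

lemma smooth_det: "(\<And>i j. smooth (\<lambda>p. B p $ i $ j)) \<Longrightarrow> smooth (\<lambda>p. det (B p :: real^'m^'m))"
  unfolding det_def by (intro smooth_sum smooth_mult smooth_const smooth_prod)

text \<open>By Cramer's rule the entries of the inverse are quotients of determinants.\<close>
lemma smooth_inv_metric: "smooth (\<lambda>p. ginv p r s)"
proof -
  define B where "B = (\<lambda>p. \<chi> i j. if j = r then (axis s 1 :: real^'n) $ i else g c p [i, j])"
  have nz: "det (metric_matrix g c p) \<noteq> 0" if "p \<in> chart_dom" for p
    using metric_invertible[OF that] invertible_det_nz by blast
  have "ginv p r s = det (B p) / det (metric_matrix g c p)" if "p \<in> chart_dom" for p
  proof -
    let ?G = "metric_matrix g c p"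
    have "?G *v (matrix_inv ?G *v axis s 1) = axis s 1"
      by (simp add: matrix_vector_mul_assoc matrix_inv_metric[OF that])
    then have "matrix_inv ?G *v axis s 1 =
        (\<chi> k. det (\<chi> i j. if j = k then (axis s 1 :: real^'n) $ i else ?G $ i $ j) / det ?G)"
      using cramer[OF nz[OF that]] by blast
    then have "(matrix_inv ?G *v axis s 1) $ r = det (B p) / det ?G"
      by (simp add: B_def metric_matrix_nth cong: if_cong)
    then show ?thesis
      by (simp add: inv_metric_def matrix_vector_mult_basis column_def)
  qed
  moreover have "smooth (\<lambda>p. det (B p) / det (metric_matrix g c p))"
  proof (intro smooth_divide smooth_det nz)
    show "smooth (\<lambda>p. B p $ i $ j)" for i j
      using metric_smooth by (cases "j = r") (auto simp: B_def)
    show "smooth (\<lambda>p. metric_matrix g c p $ i $ j)" for i j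
      unfolding metric_matrix_nth by (rule metric_smooth)
  qed
  ultimately show ?thesis by (subst smooth_cong)
qed

lemma smooth_christoffel: "smooth (\<lambda>p. \<Gamma> p k i j)"
  unfolding christoffel_def
  by (intro smooth_mult smooth_sum smooth_add smooth_diff smooth_const smooth_coord_deriv
      smooth_inv_metric metric_smooth)

lemma christoffel_sym:
  assumes "p \<in> chart_dom"
  shows "\<Gamma> p k i j = \<Gamma> p k j i"
proof -
  have "pd l (\<lambda>q. g c q [i, j]) p = pd l (\<lambda>q. g c q [j, i]) p" for l
    using metric_sym by (intro coord_deriv_cong[OF assms])
  then show ?thesis unfolding christoffel_def by (simp add: add.commute)
qed

text \<open>The Koszul formula for coordinate vector fields.\<close>
lemma lower_christoffel:
  assumes "p \<in> chart_dom"
  shows "(\<Sum>m\<in>UNIV. \<Gamma> p m i j * g c p [m, k]) =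
    (pd i (\<lambda>q. g c q [j, k]) p + pd j (\<lambda>q. g c q [i, k]) p - pd k (\<lambda>q. g c q [i, j]) p) / 2"
proof -
  define X where "X l = (pd i (\<lambda>q. g c q [j, l]) p + pd j (\<lambda>q. g c q [i, l]) p - pd l (\<lambda>q. g c q [i, j]) p) / 2" for l
  have "(\<Sum>m\<in>UNIV. \<Gamma> p m i j * g c p [m, k]) = (\<Sum>m\<in>UNIV. \<Sum>l\<in>UNIV. g c p [k, m] * ginv p m l * X l)"
    by (simp add: christoffel_def X_def sum_distrib_left sum_distrib_right metric_sym[OF assms, of k] ac_simps)
  also have "\<dots> = (\<Sum>l\<in>UNIV. (\<Sum>m\<in>UNIV. g c p [k, m] * ginv p m l) * X l)"
    by (subst sum.swap) (simp add: sum_distrib_right)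
  also have "\<dots> = X k"
    by (simp add: inv_metric_right[OF assms] sum_kronecker)
  finally show ?thesis by (simp add: X_def)
qed

lemma coord_deriv_metric:
  assumes "p \<in> chart_dom"
  shows "pd i (\<lambda>q. g c q [j, k]) p =
    (\<Sum>m\<in>UNIV. \<Gamma> p m i j * g c p [m, k]) + (\<Sum>m\<in>UNIV. \<Gamma> p m i k * g c p [j, m])"
proof -
  have "pd l (\<lambda>q. g c q [i, j]) p = pd l (\<lambda>q. g c q [j, i]) p" for l i j
    using metric_sym by (intro coord_deriv_cong[OF assms])
  then show ?thesis
    using lower_christoffel[OF assms, of i j k] lower_christoffel[OF assms, of i k j]
    by (simp add: metric_sym[OF assms, of j] field_simps)
qed

lemma cov_deriv_metric:
  "p \<in> chart_dom \<Longrightarrow> nabla g c p [i, j, k] = 0"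
  using coord_deriv_metric[of p i j k] by (simp add: cov_deriv_Cons)

text \<open>The inverse metric is parallel.  Differentiating \<open>g\<^sup>r\<^sup>s g\<^sub>s\<^sub>t = \<delta>\<^sup>r\<^sub>t\<close> expresses its
derivative by that of \<open>g\<close>.\<close>
lemma coord_deriv_inv_metric:
  assumes "p \<in> chart_dom"
  shows "pd i (\<lambda>q. ginv q r u) p =
    - (\<Sum>m\<in>UNIV. \<Gamma> p r i m * ginv p m u) - (\<Sum>m\<in>UNIV. \<Gamma> p u i m * ginv p r m)"
proof -
  have 0: "(\<Sum>s\<in>UNIV. pd i (\<lambda>q. ginv q r s) p * g c p [s, t]) =
      - (\<Sum>s\<in>UNIV. ginv p r s * pd i (\<lambda>q. g c q [s, t]) p)" for t
  proof -
    have "0 = pd i (\<lambda>q. if r = t then 1 else 0) p" by simp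
    also have "\<dots> = pd i (\<lambda>q. \<Sum>s\<in>UNIV. ginv q r s * g c q [s, t]) p"
      by (intro coord_deriv_cong[OF assms]) (simp add: inv_metric_left)
    also have "\<dots> = (\<Sum>s\<in>UNIV. ginv p r s * pd i (\<lambda>q. g c q [s, t]) p + pd i (\<lambda>q. ginv q r s) p * g c p [s, t])"
      using assms metric_smooth smooth_inv_metric by (simp add: coord_deriv_sum coord_deriv_mult smooth_mult)
    finally show ?thesis by (simp add: sum.distrib)
  qed
  have "pd i (\<lambda>q. ginv q r u) p = (\<Sum>s\<in>UNIV. pd i (\<lambda>q. ginv q r s) p * (\<Sum>t\<in>UNIV. g c p [s, t] * ginv p t u))"
    by (simp add: inv_metric_right[OF assms] sum_kronecker)
  also have "\<dots> = (\<Sum>t\<in>UNIV. (\<Sum>s\<in>UNIV. pd i (\<lambda>q. ginv q r s) p * g c p [s, t]) * ginv p t u)"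
    unfolding sum_distrib_left sum_distrib_right
    by (subst sum.swap) (simp add: ac_simps)
  also have "\<dots> = - (\<Sum>t\<in>UNIV. \<Sum>s\<in>UNIV. ginv p r s * ginv p t u *
      ((\<Sum>m\<in>UNIV. \<Gamma> p m i s * g c p [m, t]) + (\<Sum>m\<in>UNIV. \<Gamma> p m i t * g c p [s, m])))"
    unfolding 0 coord_deriv_metric[OF assms]
    by (simp add: sum_distrib_right sum_distrib_left sum_negf ac_simps)
  also have "(\<Sum>t\<in>UNIV. \<Sum>s\<in>UNIV. ginv p r s * ginv p t u *
      ((\<Sum>m\<in>UNIV. \<Gamma> p m i s * g c p [m, t]) + (\<Sum>m\<in>UNIV. \<Gamma> p m i t * g c p [s, m])))
      = (\<Sum>t\<in>UNIV. \<Sum>s\<in>UNIV. ginv p r s * ginv p t u * (\<Sum>m\<in>UNIV. \<Gamma> p m i s * g c p [m, t]))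
      + (\<Sum>t\<in>UNIV. \<Sum>s\<in>UNIV. ginv p r s * ginv p t u * (\<Sum>m\<in>UNIV. \<Gamma> p m i t * g c p [s, m]))"
    by (simp add: distrib_left sum.distrib)
  also have "(\<Sum>t\<in>UNIV. \<Sum>s\<in>UNIV. ginv p r s * ginv p t u * (\<Sum>m\<in>UNIV. \<Gamma> p m i s * g c p [m, t]))
      = (\<Sum>s\<in>UNIV. \<Sum>m\<in>UNIV. ginv p r s * \<Gamma> p m i s * (\<Sum>t\<in>UNIV. g c p [m, t] * ginv p t u))"
    unfolding sum_distrib_left
    by (subst sum.swap, rule sum.cong[OF refl], subst sum.swap) (simp add: ac_simps)
  also have "\<dots> = (\<Sum>m\<in>UNIV. \<Gamma> p u i m * ginv p r m)"
    by (simp add: inv_metric_right[OF assms] sum_kronecker) (simp add: ac_simps)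
  also have "(\<Sum>t\<in>UNIV. \<Sum>s\<in>UNIV. ginv p r s * ginv p t u * (\<Sum>m\<in>UNIV. \<Gamma> p m i t * g c p [s, m]))
      = (\<Sum>t\<in>UNIV. \<Sum>m\<in>UNIV. ginv p t u * \<Gamma> p m i t * (\<Sum>s\<in>UNIV. ginv p r s * g c p [s, m]))"
    unfolding sum_distrib_left
    by (rule sum.cong[OF refl], subst sum.swap) (simp add: ac_simps)
  also have "\<dots> = (\<Sum>m\<in>UNIV. \<Gamma> p r i m * ginv p m u)"
    by (simp add: inv_metric_left[OF assms] sum_kronecker) (simp add: ac_simps)
  finally show ?thesis by simp
qed

section \<open>The covariant derivative and metric contractions\<close>

lemma smooth_endomorphism_action:
  assumes "\<And>m k. smooth (\<lambda>p. N p m k)" "smooth_tensor (length is) T"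
  shows "smooth (\<lambda>p. endomorphism_action (N p) (T c p) is)"
  unfolding endomorphism_action_def using assms
  by (intro smooth_sum smooth_mult) (auto intro: smooth_tensorD)

lemma smooth_tensor_cov_deriv:
  assumes "smooth_tensor k T"
  shows "smooth_tensor (Suc k) (nabla T)"
  unfolding smooth_tensor_def
proof (intro allI impI)
  fix is' :: "'n list" assume "length is' = Suc k"
  then obtain i "is" where [simp]: "is' = i # is" and "length is = k" by (auto simp: length_Suc_conv)
  then show "smooth (\<lambda>p. nabla T c p is')"
    unfolding \<open>is' = i # is\<close> cov_deriv_Cons
    using assms by (intro smooth_diff smooth_coord_deriv smooth_endomorphism_action smooth_christoffel)
      (auto intro: smooth_tensorD)
qed

lemma cov_deriv_cong:
  assumes "p \<in> chart_dom" "\<And>q js. q \<in> chart_dom \<Longrightarrow> length js = length is \<Longrightarrow> T c q js = U c q js"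
  shows "nabla T c p (i # is) = nabla U c p (i # is)"
  unfolding cov_deriv_Cons using assms
  by (auto intro!: arg_cong2[where f = "(-)"] coord_deriv_cong endomorphism_action_cong)

definition metric_trace :: "('a, 'n) tensor \<Rightarrow> ('a, 'n) tensor" where
  "metric_trace T = (\<lambda>b p is. \<Sum>r\<in>UNIV. \<Sum>s\<in>UNIV. inv_metric g b p r s * T b p (r # s # is))"

lemma metric_trace_eq_contract:
  "metric_trace T c p is = contract p (\<lambda>r s. T c p (r # s # is))"
  by (simp add: metric_trace_def contract_def)

lemma smooth_tensor_metric_trace:
  "smooth_tensor (Suc (Suc k)) T \<Longrightarrow> smooth_tensor k (metric_trace T)"
  unfolding smooth_tensor_def metric_trace_def
  by (auto intro!: smooth_inv_metric smooth_sum smooth_mult)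

text \<open>Metric contraction commutes with \<open>\<nabla>\<close> since the inverse metric is parallel: its derivative cancels
the Christoffel terms of the two contracted indices.\<close>
lemma cov_deriv_metric_trace:
  assumes "smooth_tensor (Suc (Suc (length is))) T" "p \<in> chart_dom"
  shows "nabla (metric_trace T) c p (i # is) = contract p (\<lambda>r s. nabla T c p (i # r # s # is))"
proof -
  let ?N = "\<lambda>m k. \<Gamma> p m i k"
  have sm: "smooth (\<lambda>p. T c p (r # s # is))" for r s
    using assms(1) by (simp add: smooth_tensor_def)
  have "pd i (\<lambda>q. metric_trace T c q is) p = (\<Sum>r\<in>UNIV. \<Sum>s\<in>UNIV.
      ginv p r s * pd i (\<lambda>q. T c q (r # s # is)) p + pd i (\<lambda>q. ginv q r s) p * T c p (r # s # is))"
    unfolding metric_trace_def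
    by (simp add: coord_deriv_sum coord_deriv_mult smooth_sum smooth_mult smooth_inv_metric sm assms(2))
  moreover have "(\<Sum>r\<in>UNIV. \<Sum>s\<in>UNIV. pd i (\<lambda>q. ginv q r s) p * T c p (r # s # is)) =
      - (\<Sum>r\<in>UNIV. \<Sum>s\<in>UNIV. ginv p r s * (\<Sum>m\<in>UNIV. \<Gamma> p m i r * T c p (m # s # is)))
      - (\<Sum>r\<in>UNIV. \<Sum>s\<in>UNIV. ginv p r s * (\<Sum>m\<in>UNIV. \<Gamma> p m i s * T c p (r # m # is)))"
  proof -
    have "(\<Sum>r\<in>UNIV. \<Sum>s\<in>UNIV. (\<Sum>m\<in>UNIV. \<Gamma> p r i m * ginv p m s) * T c p (r # s # is)) =
        (\<Sum>r\<in>UNIV. \<Sum>s\<in>UNIV. ginv p r s * (\<Sum>m\<in>UNIV. \<Gamma> p m i r * T c p (m # s # is)))"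
    proof -
      have "(\<Sum>r\<in>UNIV. \<Sum>s\<in>UNIV. (\<Sum>m\<in>UNIV. \<Gamma> p r i m * ginv p m s) * T c p (r # s # is)) =
          (\<Sum>s\<in>UNIV. \<Sum>r\<in>UNIV. \<Sum>m\<in>UNIV. \<Gamma> p r i m * ginv p m s * T c p (r # s # is))"
        unfolding sum_distrib_right by (rule sum.swap)
      also have "\<dots> = (\<Sum>s\<in>UNIV. \<Sum>m\<in>UNIV. \<Sum>r\<in>UNIV. \<Gamma> p r i m * ginv p m s * T c p (r # s # is))"
        by (rule sum.cong[OF refl], rule sum.swap)
      also have "\<dots> = (\<Sum>m\<in>UNIV. \<Sum>s\<in>UNIV. \<Sum>r\<in>UNIV. \<Gamma> p r i m * ginv p m s * T c p (r # s # is))"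
        by (rule sum.swap)
      finally show ?thesis by (simp add: sum_distrib_left ac_simps)
    qed
    moreover have "(\<Sum>r\<in>UNIV. \<Sum>s\<in>UNIV. (\<Sum>m\<in>UNIV. \<Gamma> p s i m * ginv p r m) * T c p (r # s # is)) =
        (\<Sum>r\<in>UNIV. \<Sum>s\<in>UNIV. ginv p r s * (\<Sum>m\<in>UNIV. \<Gamma> p m i s * T c p (r # m # is)))"
      unfolding sum_distrib_right sum_distrib_left
      by (rule sum.cong[OF refl], subst sum.swap) (simp add: ac_simps)
    ultimately show ?thesis
      by (simp add: coord_deriv_inv_metric[OF assms(2)] left_diff_distrib sum_subtractf sum_negf)
  qed
  moreover have "endomorphism_action ?N (metric_trace T c p) is =
      (\<Sum>r\<in>UNIV. \<Sum>s\<in>UNIV. ginv p r s * endomorphism_action ?N (\<lambda>js. T c p (r # s # js)) is)"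
    unfolding metric_trace_def by (simp add: endomorphism_action_sum endomorphism_action_cmult)
  ultimately show ?thesis
    unfolding cov_deriv_Cons contract_def
    by (simp add: right_diff_distrib distrib_left sum_subtractf sum.distrib)
qed

text \<open>Every product needed below has a covector as its first factor; other index orders are obtained by
permuting indices.\<close>
definition covector_product :: "('a, 'n) tensor \<Rightarrow> ('a, 'n) tensor \<Rightarrow> ('a, 'n) tensor" where
  "covector_product \<alpha> T = (\<lambda>b p is. \<alpha> b p [hd is] * T b p (tl is))"

lemma covector_product_Cons [simp]: "covector_product \<alpha> T b p (r # is) = \<alpha> b p [r] * T b p is"
  by (simp add: covector_product_def)

lemma smooth_tensor_covector_product:
  assumes "smooth_tensor 1 \<alpha>" "smooth_tensor k T"
  shows "smooth_tensor (Suc k) (covector_product \<alpha> T)"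
  using assms unfolding smooth_tensor_def covector_product_def
  by (auto intro!: smooth_mult)

lemma cov_deriv_covector_product:
  assumes "smooth_tensor 1 \<alpha>" "smooth_tensor (length is) T" "p \<in> chart_dom"
  shows "nabla (covector_product \<alpha> T) c p (i # r # is) =
    nabla \<alpha> c p [i, r] * T c p is + \<alpha> c p [r] * nabla T c p (i # is)"
proof -
  have "smooth (\<lambda>q. \<alpha> c q [r])" "smooth (\<lambda>q. T c q is)"
    using assms by (auto intro: smooth_tensorD)
  then show ?thesis
    unfolding cov_deriv_Cons
    by (simp add: coord_deriv_mult assms(3) endomorphism_action_cmult)
      (simp add: sum_distrib_left left_diff_distrib right_diff_distrib ac_simps)
qed

text \<open>Stated for combinations of two tensors, so that it serves for sums, differences and multiples alike.\<close>
lemma cov_deriv_linear: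
  assumes "smooth_tensor (length is) T" "smooth_tensor (length is) U" "p \<in> chart_dom"
  shows "nabla (\<lambda>b q js. x * T b q js + y * U b q js) c p (i # is) =
    x * nabla T c p (i # is) + y * nabla U c p (i # is)"
  unfolding cov_deriv_Cons
  by (simp add: coord_deriv_add coord_deriv_cmult smooth_tensorD[OF assms(1)] smooth_tensorD[OF assms(2)]
      smooth_mult smooth_const assms(3) endomorphism_action_add endomorphism_action_cmult algebra_simps)

text \<open>Traces and products are only formed at leading indices, and \<open>\<nabla>\<close> puts its index in front.  Permutations
bring other indices there, and they let \<open>\<nabla>\<close> be applied to identities between components of a tensor
with its indices in different orders.\<close>
definition permute_indices :: "nat list \<Rightarrow> ('a, 'n) tensor \<Rightarrow> ('a, 'n) tensor" where
  "permute_indices \<pi> T = (\<lambda>b p is. T b p (map ((!) is) \<pi>))"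

lemma smooth_tensor_permute_indices:
  "smooth_tensor k T \<Longrightarrow> length \<pi> = k \<Longrightarrow> smooth_tensor k (permute_indices \<pi> T)"
  by (simp add: smooth_tensor_def permute_indices_def)

lemma cov_deriv_permute_indices:
  assumes "distinct \<pi>" "set \<pi> = {..<length is}"
  shows "nabla (permute_indices \<pi> T) c p (i # is) = nabla T c p (i # map ((!) is) \<pi>)"
  unfolding cov_deriv_Cons permute_indices_def
  by (simp add: endomorphism_action_permute[OF assms])

section \<open>The Ricci identity\<close>

lemma coord_deriv_endomorphism_action:
  assumes "\<And>m k. smooth (\<lambda>p. N p m k)" "smooth_tensor (length is) T" "p \<in> chart_dom"
  shows "pd i (\<lambda>q. endomorphism_action (N q) (T c q) is) p =
    endomorphism_action (\<lambda>m k. pd i (\<lambda>q. N q m k) p) (T c p) is +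
    endomorphism_action (N p) (\<lambda>js. pd i (\<lambda>q. T c q js) p) is"
proof -
  have "smooth (\<lambda>q. T c q (is[l := m]))" for l m
    using assms(2) by (auto intro: smooth_tensorD)
  then show ?thesis
    unfolding endomorphism_action_def
    by (simp add: coord_deriv_sum coord_deriv_mult smooth_sum smooth_mult assms(1,3) sum.distrib ac_simps)
qed

text \<open>Write \<open>\<nabla>\<^sub>i = \<partial>\<^sub>i - \<Gamma>\<^sub>i\<close>, where \<open>\<Gamma>\<^sub>i\<close> acts as a derivation.  In the commutator the second partial
derivatives and the terms with one derivative of \<open>T\<close> cancel, and so does the contribution of the
index \<open>j\<close> by symmetry of \<open>\<Gamma>\<close>; what remains is
\<open>- (\<partial>\<^sub>i\<Gamma>\<^sub>j - \<partial>\<^sub>j\<Gamma>\<^sub>i) + [\<Gamma>\<^sub>i, \<Gamma>\<^sub>j]\<close>, which is minus the action of the curvature operator.\<close>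
lemma ricci_identity:
  assumes T: "smooth_tensor (length is) T" and p: "p \<in> chart_dom"
  shows "nabla (nabla T) c p (i # j # is) - nabla (nabla T) c p (j # i # is) =
    - endomorphism_action (\<lambda>m k. curvature_operator g c p i j k m) (T c p) is"
proof -
  let ?G = "\<lambda>q i m k. \<Gamma> q m i k"
  have expand: "nabla (nabla T) c p (i # j # is) =
      pd i (pd j (\<lambda>q. T c q is)) p
      - endomorphism_action (\<lambda>m k. pd i (\<lambda>q. \<Gamma> q m j k) p) (T c p) is
      - endomorphism_action (?G p j) (\<lambda>js. pd i (\<lambda>q. T c q js) p) is
      - endomorphism_action (?G p i) (\<lambda>js. pd j (\<lambda>q. T c q js) p) is
      + endomorphism_action (?G p i) (endomorphism_action (?G p j) (T c p)) is
      - (\<Sum>m\<in>UNIV. \<Gamma> p m i j * nabla T c p (m # is))" for i j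
  proof -
    have "pd i (\<lambda>q. nabla T c q (j # is)) p = pd i (pd j (\<lambda>q. T c q is)) p
        - (endomorphism_action (\<lambda>m k. pd i (\<lambda>q. \<Gamma> q m j k) p) (T c p) is
         + endomorphism_action (?G p j) (\<lambda>js. pd i (\<lambda>q. T c q js) p) is)"
      unfolding cov_deriv_Cons
      by (subst coord_deriv_diff)
        (simp_all add: coord_deriv_endomorphism_action[OF smooth_christoffel T p]
          smooth_endomorphism_action[OF smooth_christoffel T] smooth_coord_deriv smooth_tensorD[OF T] p)
    then show ?thesis
      unfolding cov_deriv_Cons[of g "nabla T"] endomorphism_action_Cons
      unfolding cov_deriv_Cons[of g T _ _ j]
      by (simp add: endomorphism_action_diff)
  qed
  have "endomorphism_action (\<lambda>m k. curvature_operator g c p i j k m) (T c p) is =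
      endomorphism_action (\<lambda>m k. pd i (\<lambda>q. \<Gamma> q m j k) p) (T c p) is
      - endomorphism_action (\<lambda>m k. pd j (\<lambda>q. \<Gamma> q m i k) p) (T c p) is
      + endomorphism_action (\<lambda>n k. \<Sum>m\<in>UNIV. ?G p i n m * ?G p j m k - ?G p j n m * ?G p i m k) (T c p) is"
    unfolding curvature_operator_def endomorphism_action_add_left endomorphism_action_diff_left ..
  also have "endomorphism_action (\<lambda>n k. \<Sum>m\<in>UNIV. ?G p i n m * ?G p j m k - ?G p j n m * ?G p i m k) (T c p) is
      = endomorphism_action (?G p j) (endomorphism_action (?G p i) (T c p)) is
      - endomorphism_action (?G p i) (endomorphism_action (?G p j) (T c p)) is"
    by (rule endomorphism_action_commutator[symmetric])
  finally show ?thesis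
    unfolding expand[of i j] expand[of j i]
    using coord_deriv_commute[OF smooth_tensorD[OF T refl] p, of i j]
    by (simp add: christoffel_sym[OF p, of _ j i])
qed


section \<open>Symmetries of the curvature tensor\<close>

abbreviation R where "R p \<equiv> riemann g c p"
abbreviation K where "K p \<equiv> curvature_operator g c p"

lemma curvature_operator_raise:
  assumes "p \<in> chart_dom"
  shows "K p i j k m = - (\<Sum>l\<in>UNIV. ginv p m l * R p i j k l)"
proof -
  have "(\<Sum>l\<in>UNIV. ginv p m l * R p i j k l) =
      - (\<Sum>n\<in>UNIV. (\<Sum>l\<in>UNIV. ginv p m l * g c p [l, n]) * K p i j k n)"
    unfolding riemann_def sum_distrib_left sum_distrib_right mult_minus_right sum_negf
    by (subst sum.swap) (simp add: metric_sym[OF assms] ac_simps)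
  then show ?thesis by (simp add: inv_metric_left[OF assms] sum_kronecker)
qed

lemma smooth_riemann: "smooth (\<lambda>p. R p i j k l)"
  unfolding riemann_def curvature_operator_def
  by (intro smooth_minus smooth_sum smooth_mult smooth_add smooth_diff smooth_coord_deriv
      smooth_christoffel metric_smooth)

lemma curvature_operator_antisym: "K p i j k l = - K p j i k l"
  unfolding curvature_operator_def by (simp add: sum_subtractf)

lemma curvature_operator_first_bianchi:
  assumes "p \<in> chart_dom"
  shows "K p i j k l + K p j k i l + K p k i j l = 0"
proof -
  have "pd i (\<lambda>q. \<Gamma> q l j k) p = pd i (\<lambda>q. \<Gamma> q l k j) p" for i j k
    using assms christoffel_sym by (intro coord_deriv_cong)
  from this[of i j k] this[of j i k] this[of k i j] show ?thesis
    unfolding curvature_operator_def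
    by (simp add: sum_subtractf christoffel_sym[OF assms, of _ j i]
        christoffel_sym[OF assms, of _ k i] christoffel_sym[OF assms, of _ k j])
qed

lemma riemann_antisym12: "R p i j k l = - R p j i k l"
  unfolding riemann_def by (subst curvature_operator_antisym) (simp add: sum_negf)

lemma riemann_first_bianchi:
  assumes "p \<in> chart_dom"
  shows "R p i j k l + R p j k i l + R p k i j l = 0"
proof -
  have "R p i j k l + R p j k i l + R p k i j l =
      - (\<Sum>m\<in>UNIV. (K p i j k m + K p j k i m + K p k i j m) * g c p [m, l])"
    by (simp add: riemann_def distrib_right sum.distrib)
  then show ?thesis by (simp add: curvature_operator_first_bianchi[OF assms])
qed

text \<open>The Ricci identity for the parallel tensor \<open>g\<close>: the curvature operator acts on it by zero.\<close>
lemma riemann_antisym34: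
  assumes "p \<in> chart_dom"
  shows "R p i j k l = - R p i j l k"
proof -
  have g: "smooth_tensor (length [k, l]) g"
    by (auto simp: smooth_tensor_def length_Suc_conv metric_smooth numeral_2_eq_2)
  have 0: "nabla (nabla g) c p (i # [j, k, l]) = 0" for i j
  proof -
    have "nabla (nabla g) c p (i # [j, k, l]) = nabla (\<lambda>b q js. 0) c p (i # [j, k, l])"
      by (intro cov_deriv_cong assms) (auto simp: length_Suc_conv cov_deriv_metric)
    then show ?thesis by (simp add: cov_deriv_Cons)
  qed
  show ?thesis
    using ricci_identity[OF g assms, of i j] 0[of i j] 0[of j i]
    by (simp add: riemann_def metric_sym[OF assms, of k])
qed

text \<open>The classical combination of four first Bianchi identities.\<close>
lemma riemann_pair_sym:
  assumes "p \<in> chart_dom"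
  shows "R p i j k l = R p k l i j"
  using riemann_first_bianchi[OF assms, of i j k l] riemann_first_bianchi[OF assms, of j k l i]
    riemann_first_bianchi[OF assms, of k l i j] riemann_first_bianchi[OF assms, of l i j k]
    riemann_antisym12[of p i j k l] riemann_antisym12[of p i j l k] riemann_antisym34[OF assms, of i j k l]
    riemann_antisym34[OF assms, of j i k l]
    riemann_antisym12[of p j k i l] riemann_antisym12[of p j k l i] riemann_antisym34[OF assms, of j k i l]
    riemann_antisym34[OF assms, of k j i l]
    riemann_antisym12[of p k l i j] riemann_antisym12[of p k l j i] riemann_antisym34[OF assms, of k l i j]
    riemann_antisym34[OF assms, of l k i j]
    riemann_antisym12[of p l i j k] riemann_antisym12[of p l i k j] riemann_antisym34[OF assms, of l i j k]
    riemann_antisym34[OF assms, of i l j k]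
    riemann_antisym12[of p k i j l] riemann_antisym12[of p k i l j] riemann_antisym34[OF assms, of k i j l]
    riemann_antisym34[OF assms, of i k j l]
    riemann_antisym12[of p l j k i] riemann_antisym12[of p l j i k] riemann_antisym34[OF assms, of l j k i]
    riemann_antisym34[OF assms, of j l k i]
  by linarith

lemma riemann_reverse:
  assumes "p \<in> chart_dom"
  shows "R p i j k l = R p l k j i"
  using riemann_pair_sym[OF assms, of i j k l] riemann_antisym12[of p k l i j]
    riemann_antisym34[OF assms, of l k i j] by simp

definition Rm :: "('a, 'n) tensor" where
  "Rm = (\<lambda>b p is. riemann g b p (is ! 0) (is ! 1) (is ! 2) (is ! 3))"

lemma Rm_eq [simp]: "Rm c p [i, j, k, l] = R p i j k l"
  by (simp add: Rm_def)

lemma smooth_tensor_Rm: "smooth_tensor 4 Rm"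
  by (simp add: smooth_tensor_def Rm_def smooth_riemann)

text \<open>By the reversal symmetry, \<open>curvature_on \<omega>\<close> at \<open>[k, j, i]\<close> is \<open>R\<^sub>i\<^sub>j\<^sub>k\<^sub>p \<omega>\<^sup>p\<close>, the
right-hand side of the Ricci identity for \<open>\<omega>\<close>.  This index order puts the contracted index first.\<close>
abbreviation curvature_on :: "('a, 'n) tensor \<Rightarrow> ('a, 'n) tensor" where
  "curvature_on \<omega> \<equiv> metric_trace (covector_product \<omega> Rm)"

lemma smooth_tensor_curvature_on:
  "smooth_tensor 1 \<omega> \<Longrightarrow> smooth_tensor 3 (curvature_on \<omega>)"
  using smooth_tensor_metric_trace[of 3 "covector_product \<omega> Rm"]
    smooth_tensor_covector_product[OF _ smooth_tensor_Rm, of \<omega>]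
  by (simp add: numeral_eq_Suc)

lemma curvature_operator_contract:
  assumes "p \<in> chart_dom"
  shows "- (\<Sum>m\<in>UNIV. K p i j k m * v m) = contract p (\<lambda>r s. v r * R p s k j i)"
  unfolding curvature_operator_raise[OF assms] riemann_reverse[OF assms, of i j k] contract_def
  by (simp add: sum_distrib_left sum_distrib_right sum_negf ac_simps)

lemma ricci_identity_covector:
  assumes "smooth_tensor 1 \<omega>" "p \<in> chart_dom"
  shows "nabla (nabla \<omega>) c p [i, j, k] - nabla (nabla \<omega>) c p [j, i, k] = curvature_on \<omega> c p [k, j, i]"
  using ricci_identity[of "[k]" \<omega> p i j] assms curvature_operator_contract[OF assms(2), of i j k "\<lambda>m. \<omega> c p [m]"]
  by (simp add: metric_trace_eq_contract)

lemma ricci_identity_bilinear: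
  assumes "smooth_tensor 2 T" "p \<in> chart_dom"
  shows "nabla (nabla T) c p [i, j, k, l] - nabla (nabla T) c p [j, i, k, l] =
    contract p (\<lambda>r s. T c p [r, l] * R p s k j i) + contract p (\<lambda>r s. T c p [k, r] * R p s l j i)"
  using ricci_identity[of "[k, l]" T p i j] assms
    curvature_operator_contract[OF assms(2), of i j k "\<lambda>m. T c p [m, l]"]
    curvature_operator_contract[OF assms(2), of i j l "\<lambda>m. T c p [k, m]"]
  by (simp add: numeral_2_eq_2)

lemma cov_deriv_curvature_on:
  assumes "smooth_tensor 1 \<omega>" "p \<in> chart_dom"
  shows "nabla (curvature_on \<omega>) c p [h, k, j, i] =
    contract p (\<lambda>r s. nabla \<omega> c p [h, r] * R p s k j i)
    + contract p (\<lambda>r s. \<omega> c p [r] * nabla Rm c p [h, s, k, j, i])"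
  using assms smooth_tensor_Rm smooth_tensor_covector_product[OF assms(1) smooth_tensor_Rm]
  by (simp add: cov_deriv_metric_trace cov_deriv_covector_product contract_add numeral_eq_Suc)

text \<open>The Ricci identity for \<open>\<omega>\<close> differentiated once more: it is an identity of tensor fields on the whole
chart domain, up to permutations of the indices.\<close>
lemma cov_deriv_ricci_identity_covector:
  assumes "smooth_tensor 1 \<omega>" "p \<in> chart_dom"
  shows "nabla (nabla (nabla \<omega>)) c p [h, i, j, k] - nabla (nabla (nabla \<omega>)) c p [h, j, i, k]
    = nabla (curvature_on \<omega>) c p [h, k, j, i]"
proof -
  let ?A = "nabla (nabla \<omega>)"
  have sA: "smooth_tensor 3 ?A"
    using smooth_tensor_cov_deriv[OF smooth_tensor_cov_deriv[OF assms(1)]] by (simp add: numeral_3_eq_3)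
  have "nabla ?A c p (h # [i, j, k]) =
      nabla (\<lambda>b q js. 1 * permute_indices [1, 0, 2] ?A b q js + 1 * permute_indices [2, 1, 0] (curvature_on \<omega>) b q js)
        c p (h # [i, j, k])"
  proof (rule cov_deriv_cong[OF assms(2)])
    fix q and js :: "'n list" assume "q \<in> chart_dom" "length js = length [i, j, k]"
    then show "?A c q js = 1 * permute_indices [1, 0, 2] ?A c q js + 1 * permute_indices [2, 1, 0] (curvature_on \<omega>) c q js"
      using ricci_identity_covector[OF assms(1), of q "js ! 0" "js ! 1" "js ! 2"]
      by (auto simp: length_Suc_conv permute_indices_def)
  qed
  also have "\<dots> = nabla (permute_indices [1, 0, 2] ?A) c p (h # [i, j, k])
      + nabla (permute_indices [2, 1, 0] (curvature_on \<omega>)) c p (h # [i, j, k])"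
    using sA smooth_tensor_curvature_on[OF assms(1)] assms(2)
    by (subst cov_deriv_linear) (simp_all add: smooth_tensor_permute_indices numeral_eq_Suc)
  also have "nabla (permute_indices [1, 0, 2] ?A) c p (h # [i, j, k]) = nabla ?A c p [h, j, i, k]"
    by (subst cov_deriv_permute_indices) (auto simp: lessThan_Suc numeral_eq_Suc)
  also have "nabla (permute_indices [2, 1, 0] (curvature_on \<omega>)) c p (h # [i, j, k])
      = nabla (curvature_on \<omega>) c p [h, k, j, i]"
    by (subst cov_deriv_permute_indices) (auto simp: lessThan_Suc numeral_eq_Suc)
  finally show ?thesis by simp
qed

section \<open>Bianchi identities\<close>

text \<open>The cyclic sum of \<open>\<nabla>\<^sub>h(\<nabla>\<^sub>i\<nabla>\<^sub>j - \<nabla>\<^sub>j\<nabla>\<^sub>i)\<omega>\<close> over \<open>h, i, j\<close> equals that of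
\<open>(\<nabla>\<^sub>i\<nabla>\<^sub>j - \<nabla>\<^sub>j\<nabla>\<^sub>i)\<nabla>\<^sub>h\<omega>\<close> because it consists of the same six third derivatives.  The first
contains \<open>\<nabla>Rm\<close> applied to \<open>\<omega>\<close> and \<open>Rm\<close> applied to \<open>\<nabla>\<omega>\<close>, the second only the latter and a term
killed by the first Bianchi identity.\<close>
lemma second_bianchi:
  assumes "p \<in> chart_dom"
  shows "nabla Rm c p [h, l, k, j, i] + nabla Rm c p [i, l, k, h, j] + nabla Rm c p [j, l, k, i, h] = 0"
proof -
  \<comment> \<open>The metric dual of \<open>\<partial>\<^sub>l\<close> at \<open>p\<close>, extended with constant components: contraction with it
      leaves the single component with index \<open>l\<close>.\<close>
  define \<omega> :: "('a, 'n) tensor" where "\<omega> = (\<lambda>b q js. g c p [l, hd js])"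
  have \<omega>: "smooth_tensor 1 \<omega>" by (simp add: smooth_tensor_def \<omega>_def smooth_const)
  have d\<omega>: "smooth_tensor 2 (nabla \<omega>)" using smooth_tensor_cov_deriv[OF \<omega>] by (simp add: numeral_2_eq_2)
  define C where "C = (\<lambda>h j i. contract p (\<lambda>r s. nabla \<omega> c p [h, r] * R p s k j i))"
  define E where "E = (\<lambda>h j i. contract p (\<lambda>r s. \<omega> c p [r] * nabla Rm c p [h, s, k, j, i]))"
  have W: "nabla (nabla (nabla \<omega>)) c p [h, i, j, k] - nabla (nabla (nabla \<omega>)) c p [h, j, i, k] = C h j i + E h j i" for h i j
    unfolding cov_deriv_ricci_identity_covector[OF \<omega> assms] cov_deriv_curvature_on[OF \<omega> assms] C_def E_def ..
  define B where "B = (\<lambda>i j h. contract p (\<lambda>r s. nabla \<omega> c p [r, k] * R p s h j i))"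
  have V: "nabla (nabla (nabla \<omega>)) c p [i, j, h, k] - nabla (nabla (nabla \<omega>)) c p [j, i, h, k] = B i j h + C h j i" for i j h
    unfolding ricci_identity_bilinear[OF d\<omega> assms] B_def C_def ..
  have "B i j h + B j h i + B h i j = contract p (\<lambda>r s. nabla \<omega> c p [r, k] *
      (R p s h j i + R p s i h j + R p s j i h))"
    by (simp add: B_def contract_add distrib_left)
  also have "\<dots> = 0"
    using riemann_first_bianchi[OF assms, of i j h] riemann_reverse[OF assms, of _ h j i]
      riemann_reverse[OF assms, of _ i h j] riemann_reverse[OF assms, of _ j i h]
    by (simp add: contract_def)
  finally have "E h j i + E i h j + E j i h = 0"
    using W[of h i j] W[of i j h] W[of j h i] V[of i j h] V[of j h i] V[of h i j] by linarith
  moreover have "E h j i = nabla Rm c p [h, l, k, j, i]" for h j i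
    unfolding E_def \<omega>_def by (simp add: contract_metric(2)[OF assms])
  ultimately show ?thesis by simp
qed

lemma cov_deriv_Rm_pair_sym:
  assumes "p \<in> chart_dom"
  shows "nabla Rm c p [h, i, j, k, l] = nabla Rm c p [h, k, l, i, j]"
proof -
  have "nabla Rm c p (h # [i, j, k, l]) = nabla (permute_indices [2, 3, 0, 1] Rm) c p (h # [i, j, k, l])"
    by (intro cov_deriv_cong assms) (auto simp: permute_indices_def length_Suc_conv intro: riemann_pair_sym)
  also have "\<dots> = nabla Rm c p [h, k, l, i, j]"
    by (subst cov_deriv_permute_indices) (auto simp: lessThan_Suc numeral_eq_Suc)
  finally show ?thesis .
qed

lemma cov_deriv_Rm_antisym34:
  assumes "p \<in> chart_dom"
  shows "nabla Rm c p [h, i, j, k, l] = - nabla Rm c p [h, i, j, l, k]"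
proof -
  have sm: "smooth_tensor 4 (permute_indices [0, 1, 3, 2] Rm)"
    by (simp add: smooth_tensor_permute_indices smooth_tensor_Rm)
  have "nabla Rm c p (h # [i, j, k, l]) =
      nabla (\<lambda>b q js. (-1) * permute_indices [0, 1, 3, 2] Rm b q js + 0 * permute_indices [0, 1, 3, 2] Rm b q js) c p (h # [i, j, k, l])"
    by (intro cov_deriv_cong assms) (auto simp: permute_indices_def length_Suc_conv intro: riemann_antisym34)
  also have "\<dots> = - nabla (permute_indices [0, 1, 3, 2] Rm) c p (h # [i, j, k, l])"
    using sm by (subst cov_deriv_linear) (simp_all add: assms numeral_eq_Suc)
  also have "nabla (permute_indices [0, 1, 3, 2] Rm) c p (h # [i, j, k, l]) = nabla Rm c p [h, i, j, l, k]"
    by (subst cov_deriv_permute_indices) (auto simp: lessThan_Suc numeral_eq_Suc)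
  finally show ?thesis .
qed

definition Ric :: "('a, 'n) tensor" where
  "Ric = (\<lambda>b p is. ricci g b p (is ! 0) (is ! 1))"

lemma Ric_eq_trace: "length is = 2 \<Longrightarrow> Ric c p is = metric_trace (permute_indices [0, 2, 1, 3] Rm) c p is"
  by (auto simp: Ric_def ricci_def metric_trace_def permute_indices_def length_Suc_conv numeral_2_eq_2)

lemma cov_deriv_Ric:
  assumes "p \<in> chart_dom"
  shows "nabla Ric c p [h, i, j] = contract p (\<lambda>r s. nabla Rm c p [h, r, i, s, j])"
proof -
  have sm: "smooth_tensor 4 (permute_indices [0, 2, 1, 3] Rm)"
    by (simp add: smooth_tensor_permute_indices smooth_tensor_Rm)
  have "nabla Ric c p (h # [i, j]) = nabla (metric_trace (permute_indices [0, 2, 1, 3] Rm)) c p (h # [i, j])"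
    by (intro cov_deriv_cong assms Ric_eq_trace) simp
  also have "\<dots> = contract p (\<lambda>r s. nabla (permute_indices [0, 2, 1, 3] Rm) c p (h # [r, s, i, j]))"
    using sm by (subst cov_deriv_metric_trace) (simp_all add: assms numeral_eq_Suc)
  also have "\<dots> = contract p (\<lambda>r s. nabla Rm c p [h, r, i, s, j])"
    by (subst cov_deriv_permute_indices) (auto simp: lessThan_Suc numeral_eq_Suc)
  finally show ?thesis .
qed

text \<open>Contracting the second Bianchi identity turns the two other cyclic terms into derivatives of \<open>Ric\<close>,
with opposite signs by antisymmetry in the last two indices.\<close>
lemma contracted_bianchi:
  assumes "p \<in> chart_dom"
  shows "contract p (\<lambda>r s. nabla Rm c p [r, s, i, m, j]) =
    nabla Ric c p [m, i, j] - nabla Ric c p [j, i, m]"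
proof -
  have "nabla Rm c p [r, s, i, m, j] = nabla Rm c p [m, s, i, r, j] - nabla Rm c p [j, s, i, r, m]" for r s
    using second_bianchi[OF assms, of r s i m j] cov_deriv_Rm_antisym34[OF assms, of m s i j r]
    by linarith
  then have "contract p (\<lambda>r s. nabla Rm c p [r, s, i, m, j]) =
      contract p (\<lambda>r s. nabla Rm c p [m, s, i, r, j])
      - contract p (\<lambda>r s. nabla Rm c p [j, s, i, r, m])"
    by (simp add: contract_diff)
  moreover have "contract p (\<lambda>r s. nabla Rm c p [m, s, i, r, j]) = nabla Ric c p [m, i, j]" for m j
    unfolding cov_deriv_Ric[OF assms]
    by (rule contract_commute[OF assms])
  ultimately show ?thesis by simp
qed


section \<open>Hessians, the Lie derivative of the metric and the curvature action\<close>

lemma contract_riemann: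
  assumes "p \<in> chart_dom"
  shows "contract p (\<lambda>r s. R p r i s j) = ricci g c p i j"
    and "contract p (\<lambda>r s. R p i r j s) = ricci g c p i j"
    and "contract p (\<lambda>r s. R p i r s j) = - ricci g c p i j"
proof -
  show *: "contract p (\<lambda>r s. R p r i s j) = ricci g c p i j" for i j
    by (simp add: contract_def ricci_def)
  have "R p i r s j = - R p r i s j" for r s
    by (rule riemann_antisym12)
  then show "contract p (\<lambda>r s. R p i r s j) = - ricci g c p i j"
    by (simp only: contract_minus *)
  have 4: "R p r i j s = - R p r i s j" for r s
    by (rule riemann_antisym34[OF assms])
  have "R p i r j s = R p r i s j" for r s
    using riemann_antisym12[of p i r j s] 4[of r s] by linarith
  then show "contract p (\<lambda>r s. R p i r j s) = ricci g c p i j" by (simp only: *)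
qed

lemma smooth_tensor_scalar: "smooth a \<Longrightarrow> smooth_tensor 0 (scalar a)"
  by (simp add: smooth_tensor_def scalar_def)

lemma smooth_tensor_differential: "smooth a \<Longrightarrow> smooth_tensor 1 (nabla (scalar a))"
  using smooth_tensor_cov_deriv[OF smooth_tensor_scalar] by simp

lemma hessian_sym:
  assumes "smooth a" "p \<in> chart_dom"
  shows "nabla (nabla (scalar a)) c p [i, j] = nabla (nabla (scalar a)) c p [j, i]"
  using coord_deriv_commute[OF assms, of i j] christoffel_sym[OF assms(2), of _ i j]
  by (simp add: cov_deriv_Cons scalar_def)

lemma cov_deriv_sym:
  assumes "\<And>q i j. q \<in> chart_dom \<Longrightarrow> T c q [i, j] = T c q [j, i]" "p \<in> chart_dom"
  shows "nabla T c p [h, i, j] = nabla T c p [h, j, i]"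
proof -
  have "nabla T c p (h # [i, j]) = nabla (permute_indices [1, 0] T) c p (h # [i, j])"
    using assms by (intro cov_deriv_cong) (auto simp: permute_indices_def length_Suc_conv)
  also have "\<dots> = nabla T c p [h, j, i]"
    by (subst cov_deriv_permute_indices) (auto simp: lessThan_Suc)
  finally show ?thesis .
qed

lemma cov_deriv_hessian_sym:
  "smooth a \<Longrightarrow> p \<in> chart_dom \<Longrightarrow>
    nabla (nabla (nabla (scalar a))) c p [h, i, j] = nabla (nabla (nabla (scalar a))) c p [h, j, i]"
  by (rule cov_deriv_sym) (rule hessian_sym)

text \<open>Lowering the index of \<open>X = #\<omega>\<close> under the derivative turns \<open>\<partial>\<^sub>i X\<^sup>k g\<^sub>k\<^sub>j\<close> into \<open>\<partial>\<^sub>i \<omega>\<^sub>j - X\<^sup>k \<partial>\<^sub>i g\<^sub>k\<^sub>j\<close>; the derivatives of \<open>g\<close>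
then combine to \<open>-2 \<Gamma>\<^sup>m\<^sub>i\<^sub>j \<omega>\<^sub>m\<close>.\<close>
lemma lie_deriv_sharp_metric:
  assumes "smooth_tensor 1 \<omega>" "p \<in> chart_dom"
  shows "lie_deriv (sharp g \<omega>) g c p [i, j] = nabla \<omega> c p [i, j] + nabla \<omega> c p [j, i]"
proof -
  let ?X = "sharp g \<omega> c"
  have sX: "smooth (\<lambda>q. ?X q k)" for k
    unfolding sharp_def using assms(1)
    by (intro smooth_sum smooth_mult smooth_inv_metric) (simp add: smooth_tensor_def)
  have lower: "(\<Sum>k\<in>UNIV. ?X q k * g c q [k, j]) = \<omega> c q [j]" if "q \<in> chart_dom" for q j
  proof -
    have "(\<Sum>k\<in>UNIV. ?X q k * g c q [k, j]) = (\<Sum>l\<in>UNIV. (\<Sum>k\<in>UNIV. ginv q l k * g c q [k, j]) * \<omega> c q [l])"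
      unfolding sharp_def sum_distrib_right
      by (subst sum.swap) (simp add: inv_metric_sym[OF that] ac_simps)
    then show ?thesis by (simp add: inv_metric_left[OF that] sum_kronecker)
  qed
  have dlower: "(\<Sum>k\<in>UNIV. pd i (\<lambda>q. ?X q k) p * g c p [k, j]) =
      pd i (\<lambda>q. \<omega> c q [j]) p - (\<Sum>k\<in>UNIV. ?X p k * pd i (\<lambda>q. g c q [k, j]) p)" for i j
  proof -
    have "pd i (\<lambda>q. \<omega> c q [j]) p = pd i (\<lambda>q. \<Sum>k\<in>UNIV. ?X q k * g c q [k, j]) p"
      by (intro coord_deriv_cong[OF assms(2)]) (simp add: lower)
    also have "\<dots> = (\<Sum>k\<in>UNIV. ?X p k * pd i (\<lambda>q. g c q [k, j]) p + pd i (\<lambda>q. ?X q k) p * g c p [k, j])"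
      by (simp add: coord_deriv_sum coord_deriv_mult sX metric_smooth smooth_mult assms(2))
    finally show ?thesis by (simp add: sum.distrib)
  qed
  have \<Gamma>: "(\<Sum>m\<in>UNIV. \<Gamma> p m i j * \<omega> c p [m]) = (\<Sum>k\<in>UNIV. ?X p k *
      ((pd i (\<lambda>q. g c q [j, k]) p + pd j (\<lambda>q. g c q [i, k]) p - pd k (\<lambda>q. g c q [i, j]) p) / 2))"
    unfolding lower_christoffel[OF assms(2), symmetric] lower[OF assms(2), symmetric] sum_distrib_left
    by (subst sum.swap) (simp add: metric_sym[OF assms(2)] ac_simps)
  have sym: "pd l (\<lambda>q. g c q [i, j]) p = pd l (\<lambda>q. g c q [j, i]) p" for l i j
    using metric_sym by (intro coord_deriv_cong[OF assms(2)])
  have "lie_deriv (sharp g \<omega>) g c p [i, j] = (\<Sum>k\<in>UNIV. ?X p k * pd k (\<lambda>q. g c q [i, j]) p)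
      + (\<Sum>k\<in>UNIV. pd i (\<lambda>q. ?X q k) p * g c p [k, j])
      + (\<Sum>k\<in>UNIV. pd j (\<lambda>q. ?X q k) p * g c p [k, i])"
    by (simp add: lie_deriv_def sum.distrib metric_sym[OF assms(2), of i])
  also have "\<dots> = pd i (\<lambda>q. \<omega> c q [j]) p + pd j (\<lambda>q. \<omega> c q [i]) p - 2 * (\<Sum>m\<in>UNIV. \<Gamma> p m i j * \<omega> c p [m])"
    unfolding dlower \<Gamma> sum_distrib_left
    unfolding sym[of i _ j] sym[of j _ i]
    by (simp add: sum_subtractf sum.distrib sum_distrib_left[symmetric] right_diff_distrib distrib_left
        add_divide_distrib diff_divide_distrib sum_divide_distrib[symmetric])
  finally show ?thesis
    by (simp add: cov_deriv_Cons christoffel_sym[OF assms(2), of _ j i])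
qed

lemma riemann_action_eq_contract:
  assumes "p \<in> chart_dom"
  shows "riemann_action g T c p [i, j] = contract p (\<lambda>r s. contract p (\<lambda>m q. T c p [s, m] * R p q j r i))"
proof -
  have "riemann_action g T c p [i, j] = (\<Sum>r\<in>UNIV. \<Sum>q\<in>UNIV. \<Sum>s\<in>UNIV. \<Sum>m\<in>UNIV.
      ginv p r s * ginv p m q * (T c p [s, m] * R p q j r i))"
    unfolding riemann_action_def sum_distrib_left
    by (simp add: riemann_pair_sym[OF assms, of _ i] inv_metric_sym[OF assms] ac_simps)
  also have "\<dots> = (\<Sum>r\<in>UNIV. \<Sum>s\<in>UNIV. \<Sum>q\<in>UNIV. \<Sum>m\<in>UNIV.
      ginv p r s * ginv p m q * (T c p [s, m] * R p q j r i))"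
    by (rule sum.cong[OF refl], rule sum.swap)
  also have "\<dots> = (\<Sum>r\<in>UNIV. \<Sum>s\<in>UNIV. \<Sum>m\<in>UNIV. \<Sum>q\<in>UNIV.
      ginv p r s * ginv p m q * (T c p [s, m] * R p q j r i))"
    by (rule sum.cong[OF refl], rule sum.cong[OF refl], rule sum.swap)
  finally show ?thesis by (simp add: contract_def sum_distrib_left mult.assoc)
qed

lemma riemann_action_transpose:
  assumes "p \<in> chart_dom"
  shows "riemann_action g (permute_indices [1, 0] T) c p [i, j] = riemann_action g T c p [j, i]"
proof -
  have "riemann_action g (permute_indices [1, 0] T) c p [i, j] =
      contract p (\<lambda>r s. contract p (\<lambda>m q. T c p [m, s] * R p q j r i))"
    by (simp add: riemann_action_eq_contract[OF assms] permute_indices_def)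
  also have "\<dots> = contract p (\<lambda>r s. contract p (\<lambda>m q. T c p [q, r] * R p m j s i))"
    by (subst contract_commute[OF assms], subst contract_commute[OF assms, of "\<lambda>m q. T c p [m, _] * _ m q"]) simp
  also have "\<dots> = contract p (\<lambda>m q. contract p (\<lambda>r s. T c p [q, r] * R p m j s i))"
    by (rule contract_contract)
  also have "\<dots> = riemann_action g T c p [j, i]"
    unfolding riemann_action_eq_contract[OF assms]
    by (simp add: riemann_pair_sym[OF assms, of _ j _ i] cong: sum.cong)
  finally show ?thesis .
qed

end

section \<open>The weighted Laplacian\<close>

locale weighted_riemannian_chart = riemannian_chart c g
  for c :: "('a, 'n::finite) chart" and g :: "('a, 'n) tensor" +
  fixes f :: "'a \<Rightarrow> real"
  assumes potential_smooth: "smooth f"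
begin

abbreviation "lap \<equiv> weighted_laplacian g f"
abbreviation "df \<equiv> nabla (scalar f)"
abbreviation "Hess \<equiv> nabla (nabla (scalar f))"

lemma df_eq: "df c p [r] = pd r f p"
  by (simp add: cov_deriv_Cons scalar_def)

lemma smooth_tensor_df: "smooth_tensor 1 df"
  by (rule smooth_tensor_differential[OF potential_smooth])

lemma weighted_laplacian_eq_contract:
  "lap T c p is = contract p (\<lambda>r s. nabla (nabla T) c p (r # s # is) - df c p [r] * nabla T c p (s # is))"
  by (simp add: weighted_laplacian_def laplacian_def contract_def df_eq
      right_diff_distrib sum_subtractf mult.assoc)

text \<open>This form exposes smoothness and the derivative of \<open>\<Delta>\<^sub>f T\<close>, since linear combinations, traces and
products with \<open>df\<close> have been treated above.\<close>
lemma weighted_laplacian_eq_traces: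
  "lap T c p is = 1 * metric_trace (nabla (nabla T)) c p is + (-1) * metric_trace (covector_product df (nabla T)) c p is"
  by (simp add: weighted_laplacian_eq_contract metric_trace_eq_contract contract_diff)

lemma smooth_tensor_weighted_laplacian:
  assumes "smooth_tensor k T"
  shows "smooth_tensor k (lap T)"
proof -
  have T1: "smooth_tensor (Suc k) (nabla T)" by (rule smooth_tensor_cov_deriv[OF assms])
  have T2: "smooth_tensor (Suc (Suc k)) (nabla (nabla T))" by (rule smooth_tensor_cov_deriv[OF T1])
  show ?thesis
    using smooth_tensor_metric_trace[OF T2]
      smooth_tensor_metric_trace[OF smooth_tensor_covector_product[OF smooth_tensor_df T1]]
    unfolding smooth_tensor_def weighted_laplacian_eq_traces
    by (auto intro!: smooth_add smooth_mult smooth_const)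
qed

lemma weighted_laplacian_cong:
  assumes "p \<in> chart_dom" "\<And>q js. q \<in> chart_dom \<Longrightarrow> length js = length is \<Longrightarrow> T c q js = U c q js"
  shows "lap T c p is = lap U c p is"
proof -
  have 1: "nabla T c q js = nabla U c q js" if "q \<in> chart_dom" "length js = Suc (length is)" for q js
    using that assms(2) by (auto simp: length_Suc_conv intro!: cov_deriv_cong)
  have "nabla (nabla T) c p (r # s # is) = nabla (nabla U) c p (r # s # is)" for r s
    by (intro cov_deriv_cong assms(1) 1) simp_all
  then show ?thesis
    unfolding weighted_laplacian_eq_contract using 1[OF assms(1)] by simp
qed

lemma weighted_laplacian_linear:
  assumes "smooth_tensor (length is) T" "smooth_tensor (length is) U" "p \<in> chart_dom"
  shows "lap (\<lambda>b q js. x * T b q js + y * U b q js) c p is = x * lap T c p is + y * lap U c p is"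
proof -
  have 1: "nabla (\<lambda>b q js. x * T b q js + y * U b q js) c q js = x * nabla T c q js + y * nabla U c q js"
    if "q \<in> chart_dom" "length js = Suc (length is)" for q js
    using that assms(1,2) by (auto simp: length_Suc_conv intro!: cov_deriv_linear)
  have "nabla (nabla (\<lambda>b q js. x * T b q js + y * U b q js)) c p (r # s # is) =
      nabla (\<lambda>b q js. x * nabla T b q js + y * nabla U b q js) c p (r # s # is)" for r s
    by (intro cov_deriv_cong assms(3)) (simp add: 1)
  also have "nabla (\<lambda>b q js. x * nabla T b q js + y * nabla U b q js) c p (r # s # is) =
      x * nabla (nabla T) c p (r # s # is) + y * nabla (nabla U) c p (r # s # is)" for r s
    using assms by (intro cov_deriv_linear) (simp_all add: smooth_tensor_cov_deriv)
  finally have "lap (\<lambda>b q js. x * T b q js + y * U b q js) c p is =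
      contract p (\<lambda>r s. x * (nabla (nabla T) c p (r # s # is) - df c p [r] * nabla T c p (s # is))
        + y * (nabla (nabla U) c p (r # s # is) - df c p [r] * nabla U c p (s # is)))"
    unfolding weighted_laplacian_eq_contract using 1[OF assms(3)] by (simp add: algebra_simps)
  then show ?thesis
    by (simp only: contract_add contract_cmult weighted_laplacian_eq_contract)
qed

lemma cov_deriv_weighted_laplacian:
  assumes "smooth_tensor (length is) T" "p \<in> chart_dom"
  shows "nabla (lap T) c p (i # is) = contract p (\<lambda>r s. nabla (nabla (nabla T)) c p (i # r # s # is)
    - Hess c p [i, r] * nabla T c p (s # is) - df c p [r] * nabla (nabla T) c p (i # s # is))"
proof -
  have T1: "smooth_tensor (Suc (length is)) (nabla T)" by (rule smooth_tensor_cov_deriv[OF assms(1)])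
  have T2: "smooth_tensor (Suc (Suc (length is))) (nabla (nabla T))" by (rule smooth_tensor_cov_deriv[OF T1])
  have P: "smooth_tensor (Suc (Suc (length is))) (covector_product df (nabla T))"
    by (rule smooth_tensor_covector_product[OF smooth_tensor_df T1])
  have "nabla (lap T) c p (i # is) = nabla (\<lambda>b q js. 1 * metric_trace (nabla (nabla T)) b q js
      + (-1) * metric_trace (covector_product df (nabla T)) b q js) c p (i # is)"
    by (intro cov_deriv_cong assms(2) weighted_laplacian_eq_traces)
  also have "\<dots> = 1 * nabla (metric_trace (nabla (nabla T))) c p (i # is)
      + (-1) * nabla (metric_trace (covector_product df (nabla T))) c p (i # is)"
    by (intro cov_deriv_linear smooth_tensor_metric_trace T2 P assms(2))
  also have "nabla (metric_trace (nabla (nabla T))) c p (i # is) =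
      contract p (\<lambda>r s. nabla (nabla (nabla T)) c p (i # r # s # is))"
    by (rule cov_deriv_metric_trace[OF T2 assms(2)])
  also have "nabla (metric_trace (covector_product df (nabla T))) c p (i # is) =
      contract p (\<lambda>r s. Hess c p [i, r] * nabla T c p (s # is) + df c p [r] * nabla (nabla T) c p (i # s # is))"
    unfolding cov_deriv_metric_trace[OF P assms(2)]
    by (subst cov_deriv_covector_product) (simp_all add: smooth_tensor_df[simplified] T1 assms(2))
  finally show ?thesis by (simp add: contract_diff contract_add)
qed

text \<open>\<open>\<Delta>\<^sub>f\<close> commutes with the trace because \<open>\<nabla>\<close> does.  For the second derivative, the derivative index of
\<open>\<nabla>T\<close> is moved behind the two contracted ones, so that the trace is again over leading indices.\<close>
lemma weighted_laplacian_metric_trace: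
  assumes "smooth_tensor 2 T" "p \<in> chart_dom"
  shows "lap (metric_trace T) c p [] = contract p (\<lambda>i j. lap T c p [i, j])"
proof -
  have T: "smooth_tensor (Suc (Suc 0)) T" using assms(1) by (simp add: numeral_2_eq_2)
  have sU: "smooth_tensor 3 (permute_indices [2, 0, 1] (nabla T))"
    using smooth_tensor_cov_deriv[OF T] by (simp add: smooth_tensor_permute_indices numeral_eq_Suc)
  have 1: "nabla (metric_trace T) c q [s] = contract q (\<lambda>i j. nabla T c q [s, i, j])" if "q \<in> chart_dom" for q s
    using cov_deriv_metric_trace[of "[]" T q s] T that by simp
  have 2: "nabla (nabla (metric_trace T)) c p [r, s] = contract p (\<lambda>i j. nabla (nabla T) c p [r, s, i, j])" for r s
  proof -
    have "nabla (nabla (metric_trace T)) c p (r # [s]) =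
        nabla (metric_trace (permute_indices [2, 0, 1] (nabla T))) c p (r # [s])"
      by (intro cov_deriv_cong assms(2))
        (auto simp: 1 metric_trace_eq_contract permute_indices_def length_Suc_conv)
    also have "\<dots> = contract p (\<lambda>i j. nabla (permute_indices [2, 0, 1] (nabla T)) c p (r # [i, j, s]))"
      using sU by (subst cov_deriv_metric_trace) (simp_all add: assms(2) numeral_eq_Suc)
    also have "\<dots> = contract p (\<lambda>i j. nabla (nabla T) c p [r, s, i, j])"
      by (subst cov_deriv_permute_indices) (auto simp: lessThan_Suc numeral_eq_Suc)
    finally show ?thesis .
  qed
  have "lap (metric_trace T) c p [] = contract p (\<lambda>r s. contract p (\<lambda>i j.
      nabla (nabla T) c p [r, s, i, j] - df c p [r] * nabla T c p [s, i, j]))"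
    unfolding weighted_laplacian_eq_contract by (simp add: 1 2 assms(2) contract_diff contract_cmult)
  also have "\<dots> = contract p (\<lambda>i j. lap T c p [i, j])"
    unfolding weighted_laplacian_eq_contract by (rule contract_contract)
  finally show ?thesis .
qed

lemma weighted_laplacian_transpose:
  assumes "p \<in> chart_dom"
  shows "lap (permute_indices [1, 0] T) c p [i, j] = lap T c p [j, i]"
proof -
  have 1: "nabla (permute_indices [1, 0] T) c q [s, i, j] = nabla T c q [s, j, i]" for q s i j
    by (subst cov_deriv_permute_indices) (auto simp: lessThan_Suc)
  have "nabla (nabla (permute_indices [1, 0] T)) c p (r # [s, i, j]) =
      nabla (permute_indices [0, 2, 1] (nabla T)) c p (r # [s, i, j])" for r s
    using 1 by (intro cov_deriv_cong assms) (auto simp: permute_indices_def length_Suc_conv)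
  also have "nabla (permute_indices [0, 2, 1] (nabla T)) c p (r # [s, i, j]) = nabla (nabla T) c p [r, s, j, i]" for r s
    by (subst cov_deriv_permute_indices) (auto simp: lessThan_Suc numeral_eq_Suc)
  finally show ?thesis
    unfolding weighted_laplacian_eq_contract 1 by simp
qed

text \<open>The Leibniz rule of second order; the drift term of \<open>\<Delta>\<^sub>f\<close> is a derivation and adds nothing new.\<close>
lemma weighted_laplacian_covector_product:
  assumes "smooth_tensor 1 \<alpha>" "smooth_tensor 1 \<beta>" "p \<in> chart_dom"
  shows "lap (covector_product \<alpha> \<beta>) c p [i, j] = lap \<alpha> c p [i] * \<beta> c p [j] + \<alpha> c p [i] * lap \<beta> c p [j]
    + 2 * contract p (\<lambda>r s. nabla \<alpha> c p [r, i] * nabla \<beta> c p [s, j])"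
proof -
  have s1: "smooth_tensor 2 (nabla \<alpha>)" "smooth_tensor 2 (nabla \<beta>)"
    using smooth_tensor_cov_deriv[OF assms(1)] smooth_tensor_cov_deriv[OF assms(2)] by (simp_all add: numeral_2_eq_2)
  \<comment> \<open>The two summands of \<open>\<nabla>(\<alpha> \<otimes> \<beta>)\<close>, each written as a product with a leading covector.\<close>
  let ?S = "permute_indices [2, 0, 1] (covector_product \<beta> (nabla \<alpha>))"
  let ?T = "permute_indices [1, 0, 2] (covector_product \<alpha> (nabla \<beta>))"
  have sm: "smooth_tensor 3 ?S" "smooth_tensor 3 ?T"
    using smooth_tensor_covector_product[OF assms(2) s1(1)] smooth_tensor_covector_product[OF assms(1) s1(2)]
    by (auto intro!: smooth_tensor_permute_indices)
  have 1: "nabla (covector_product \<alpha> \<beta>) c q [s, i, j] = nabla \<alpha> c q [s, i] * \<beta> c q [j] + \<alpha> c q [i] * nabla \<beta> c q [s, j]"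
    if "q \<in> chart_dom" for q s i j
    using assms that by (simp add: cov_deriv_covector_product)
  have 2: "nabla (nabla (covector_product \<alpha> \<beta>)) c p [r, s, i, j] =
      (nabla \<beta> c p [r, j] * nabla \<alpha> c p [s, i] + \<beta> c p [j] * nabla (nabla \<alpha>) c p [r, s, i])
      + (nabla \<alpha> c p [r, i] * nabla \<beta> c p [s, j] + \<alpha> c p [i] * nabla (nabla \<beta>) c p [r, s, j])" for r s
  proof -
    have "nabla (nabla (covector_product \<alpha> \<beta>)) c p (r # [s, i, j]) =
        nabla (\<lambda>b q js. 1 * ?S b q js + 1 * ?T b q js) c p (r # [s, i, j])"
      by (intro cov_deriv_cong assms(3)) (auto simp: 1 permute_indices_def length_Suc_conv)
    also have "\<dots> = 1 * nabla ?S c p (r # [s, i, j]) + 1 * nabla ?T c p (r # [s, i, j])"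
      using sm assms(3) by (intro cov_deriv_linear) (simp_all add: numeral_eq_Suc)
    also have "nabla ?S c p (r # [s, i, j]) = nabla (covector_product \<beta> (nabla \<alpha>)) c p [r, j, s, i]"
      by (subst cov_deriv_permute_indices) (auto simp: lessThan_Suc numeral_eq_Suc)
    also have "nabla ?T c p (r # [s, i, j]) = nabla (covector_product \<alpha> (nabla \<beta>)) c p [r, i, s, j]"
      by (subst cov_deriv_permute_indices) (auto simp: lessThan_Suc numeral_eq_Suc)
    finally show ?thesis
      using s1 assms by (simp add: cov_deriv_covector_product numeral_2_eq_2)
  qed
  have "lap (covector_product \<alpha> \<beta>) c p [i, j] = contract p (\<lambda>r s.
      (nabla (nabla \<alpha>) c p [r, s, i] - df c p [r] * nabla \<alpha> c p [s, i]) * \<beta> c p [j]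
      + \<alpha> c p [i] * (nabla (nabla \<beta>) c p [r, s, j] - df c p [r] * nabla \<beta> c p [s, j])
      + nabla \<alpha> c p [s, i] * nabla \<beta> c p [r, j] + nabla \<alpha> c p [r, i] * nabla \<beta> c p [s, j])"
    unfolding weighted_laplacian_eq_contract 1[OF assms(3)] 2 by (simp add: algebra_simps)
  also have "\<dots> = lap \<alpha> c p [i] * \<beta> c p [j] + \<alpha> c p [i] * lap \<beta> c p [j]
      + contract p (\<lambda>r s. nabla \<alpha> c p [s, i] * nabla \<beta> c p [r, j])
      + contract p (\<lambda>r s. nabla \<alpha> c p [r, i] * nabla \<beta> c p [s, j])"
    unfolding contract_add weighted_laplacian_eq_contract contract_cmult contract_cmult_right ..
  also have "contract p (\<lambda>r s. nabla \<alpha> c p [s, i] * nabla \<beta> c p [r, j]) =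
      contract p (\<lambda>r s. nabla \<alpha> c p [r, i] * nabla \<beta> c p [s, j])"
    by (rule contract_commute[OF assms(3)])
  finally show ?thesis by simp
qed

text \<open>The coefficients \<open>1\<close> and \<open>-1\<close> match the form of \<open>weighted_laplacian_linear\<close>.\<close>
lemma weighted_div_eq_trace:
  "weighted_div g f \<omega> c p [] = metric_trace (\<lambda>b q js. 1 * nabla \<omega> b q js + (-1) * covector_product \<omega> df b q js) c p []"
  by (simp add: weighted_div_def metric_trace_def df_eq)

lemma weighted_div_eq_contract:
  "weighted_div g f \<omega> c p [] = contract p (\<lambda>r s. nabla \<omega> c p [r, s]) - contract p (\<lambda>r s. \<omega> c p [r] * df c p [s])"
  by (simp add: weighted_div_eq_trace metric_trace_eq_contract contract_diff)

end

section \<open>Gradient Ricci shrinkers\<close>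

locale shrinker_chart = weighted_riemannian_chart c g f
  for c :: "('a, 'n::finite) chart" and g :: "('a, 'n) tensor" and f :: "'a \<Rightarrow> real" +
  fixes \<tau> :: real
  assumes soliton: "p \<in> chart_dom \<Longrightarrow> ricci g c p i j + Hess c p [i, j] = 1 / (2 * \<tau>) * g c p [i, j]"
begin

abbreviation "\<kappa> \<equiv> 1 / (2 * \<tau>)"

lemma Hess_sym: "p \<in> chart_dom \<Longrightarrow> Hess c p [i, j] = Hess c p [j, i]"
  by (rule hessian_sym[OF potential_smooth])

lemma smooth_tensor_Hess: "smooth_tensor 2 Hess"
  using smooth_tensor_cov_deriv[OF smooth_tensor_df] by (simp add: numeral_2_eq_2)

lemma contract_soliton:
  assumes "p \<in> chart_dom"
  shows "contract p (\<lambda>m q. v m * ricci g c p q i) + contract p (\<lambda>m q. v m * Hess c p [q, i]) = \<kappa> * v i"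
proof -
  have "contract p (\<lambda>m q. v m * ricci g c p q i) + contract p (\<lambda>m q. v m * Hess c p [q, i]) =
      contract p (\<lambda>m q. \<kappa> * (v m * g c p [q, i]))"
    unfolding contract_add[symmetric] distrib_left[symmetric] soliton[OF assms] by (simp add: ac_simps)
  then show ?thesis by (simp only: contract_cmult contract_metric(1)[OF assms])
qed

lemma cov_deriv_Ric_soliton:
  assumes "p \<in> chart_dom"
  shows "nabla Ric c p [h, i, j] = - nabla Hess c p [h, i, j]"
proof -
  have g: "smooth_tensor 2 g"
    by (auto simp: smooth_tensor_def length_Suc_conv metric_smooth numeral_2_eq_2)
  have "nabla Ric c p (h # [i, j]) = nabla (\<lambda>b q js. \<kappa> * g b q js + (-1) * Hess b q js) c p (h # [i, j])"
  proof (rule cov_deriv_cong[OF assms])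
    fix q and js :: "'n list" assume "q \<in> chart_dom" "length js = length [i, j]"
    then show "Ric c q js = \<kappa> * g c q js + (-1) * Hess c q js"
      using soliton[of q "js ! 0" "js ! 1"] by (auto simp: Ric_def length_Suc_conv)
  qed
  also have "\<dots> = \<kappa> * nabla g c p (h # [i, j]) + (-1) * nabla Hess c p (h # [i, j])"
    using g smooth_tensor_Hess assms by (intro cov_deriv_linear) (simp_all add: numeral_2_eq_2)
  finally show ?thesis by (simp add: cov_deriv_metric[OF assms])
qed

text \<open>The contracted Bianchi identity gives \<open>\<nabla>\<^sup>r R\<^sub>r\<^sub>i\<^sub>m\<^sub>j = \<nabla>\<^sub>m R\<^sub>i\<^sub>j - \<nabla>\<^sub>j R\<^sub>i\<^sub>m\<close>.  By the
soliton equation this is \<open>\<nabla>\<^sub>j\<nabla>\<^sub>m\<nabla>\<^sub>i f - \<nabla>\<^sub>m\<nabla>\<^sub>j\<nabla>\<^sub>i f\<close>, which the Ricci identity evaluates.\<close>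
lemma weighted_div_Rm:
  assumes "p \<in> chart_dom"
  shows "contract p (\<lambda>r s. nabla Rm c p [r, s, i, m, j] - df c p [r] * R p s i m j) = 0"
proof -
  have "contract p (\<lambda>r s. nabla Rm c p [r, s, i, m, j]) = nabla Hess c p [j, i, m] - nabla Hess c p [m, i, j]"
    unfolding contracted_bianchi[OF assms] cov_deriv_Ric_soliton[OF assms] by simp
  also have "\<dots> = nabla Hess c p [j, m, i] - nabla Hess c p [m, j, i]"
    by (simp only: cov_deriv_hessian_sym[OF potential_smooth assms, of _ i])
  also have "\<dots> = contract p (\<lambda>r s. df c p [r] * R p s i m j)"
    using ricci_identity_covector[OF smooth_tensor_df assms, of j m i]
    by (simp add: metric_trace_eq_contract)
  finally show ?thesis by (simp add: contract_diff)
qed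

text \<open>Up to sign the trace of \<open>weighted_div_Rm\<close> over \<open>i\<close> and \<open>m\<close>.\<close>
lemma weighted_div_Ric:
  assumes "p \<in> chart_dom"
  shows "contract p (\<lambda>r s. nabla Ric c p [r, s, j] - df c p [r] * ricci g c p s j) = 0"
proof -
  have 1: "contract p (\<lambda>i m. nabla Rm c p [r, s, i, m, j]) = - nabla Ric c p [r, s, j]" for r s
  proof -
    have "nabla Rm c p [r, s, i, m, j] = - nabla Rm c p [r, i, s, m, j]" for i m
      using cov_deriv_Rm_pair_sym[OF assms, of r s i m j] cov_deriv_Rm_antisym34[OF assms, of r m j s i]
        cov_deriv_Rm_pair_sym[OF assms, of r m j i s] by linarith
    then show ?thesis by (simp only: contract_minus cov_deriv_Ric[OF assms])
  qed
  have 2: "contract p (\<lambda>i m. R p s i m j) = - ricci g c p s j" for s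
    by (rule contract_riemann(3)[OF assms])
  have "0 = contract p (\<lambda>i m. contract p (\<lambda>r s. nabla Rm c p [r, s, i, m, j] - df c p [r] * R p s i m j))"
    unfolding weighted_div_Rm[OF assms] by (simp add: contract_def)
  also have "\<dots> = contract p (\<lambda>r s. contract p (\<lambda>i m. nabla Rm c p [r, s, i, m, j] - df c p [r] * R p s i m j))"
    by (rule contract_contract)
  also have "\<dots> = contract p (\<lambda>r s. - (nabla Ric c p [r, s, j] - df c p [r] * ricci g c p s j))"
    unfolding contract_diff contract_cmult 1 2 by (simp add: contract_diff[symmetric])
  finally show ?thesis unfolding contract_minus by simp
qed

text \<open>Since \<open>\<nabla>Hess f = -\<nabla>Ric\<close>, the divergence of \<open>Hess f\<close> is \<open>-Ric(\<nabla>f)\<close>, and the drift term contributes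
\<open>-Hess f(\<nabla>f)\<close>; the soliton equation adds them up.\<close>
lemma weighted_laplacian_df:
  assumes "p \<in> chart_dom"
  shows "lap df c p [j] = - \<kappa> * df c p [j]"
proof -
  have "lap df c p [j] = contract p (\<lambda>r s. nabla Hess c p [r, s, j]) - contract p (\<lambda>r s. df c p [r] * Hess c p [s, j])"
    by (simp add: weighted_laplacian_eq_contract contract_diff)
  also have "contract p (\<lambda>r s. nabla Hess c p [r, s, j]) = - contract p (\<lambda>r s. df c p [r] * ricci g c p s j)"
    using weighted_div_Ric[OF assms, of j] unfolding cov_deriv_Ric_soliton[OF assms] contract_diff contract_minus
    by simp
  finally show ?thesis using contract_soliton[OF assms, of "\<lambda>m. df c p [m]" j] by simp
qed

text \<open>The Bochner formula.  As \<open>\<nabla>da\<close> is symmetric, \<open>\<nabla>\<^sub>r\<nabla>\<^sub>s\<nabla>\<^sub>i a = \<nabla>\<^sub>r\<nabla>\<^sub>i\<nabla>\<^sub>s a\<close>, and a single commutation of \<open>\<nabla>\<^sub>r\<close> with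
\<open>\<nabla>\<^sub>i\<close> yields the Ricci term; the Hessian term comes from differentiating \<open>\<nabla>f\<close> in the drift.\<close>
lemma weighted_laplacian_differential:
  assumes "smooth a" "p \<in> chart_dom"
  shows "lap (nabla (scalar a)) c p [i] = nabla (lap (scalar a)) c p [i] + \<kappa> * nabla (scalar a) c p [i]"
proof -
  let ?u = "nabla (scalar a)"
  have sa: "smooth_tensor (length []) (scalar a)" using smooth_tensor_scalar[OF assms(1)] by simp
  have u: "smooth_tensor 1 ?u" by (rule smooth_tensor_differential[OF assms(1)])
  have comm: "nabla (nabla ?u) c p [r, s, i] = nabla (nabla ?u) c p [i, r, s] + contract p (\<lambda>m q. ?u c p [m] * R p q s i r)" for r s
    using ricci_identity_covector[OF u assms(2), of r i s] cov_deriv_hessian_sym[OF assms, of r s i]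
    by (simp add: metric_trace_eq_contract)
  have "contract p (\<lambda>r s. contract p (\<lambda>m q. ?u c p [m] * R p q s i r)) =
      contract p (\<lambda>m q. contract p (\<lambda>r s. ?u c p [m] * R p q s i r))"
    by (rule contract_contract)
  also have "\<dots> = contract p (\<lambda>m q. ?u c p [m] * ricci g c p q i)"
    unfolding contract_cmult
    by (subst contract_commute[OF assms(2), of "\<lambda>r s. R p _ s i r"]) (simp add: contract_riemann(2)[OF assms(2)])
  finally have ric: "contract p (\<lambda>r s. contract p (\<lambda>m q. ?u c p [m] * R p q s i r)) =
      contract p (\<lambda>m q. ?u c p [m] * ricci g c p q i)" .
  have "contract p (\<lambda>r s. Hess c p [i, r] * ?u c p [s]) = contract p (\<lambda>m q. ?u c p [m] * Hess c p [q, i])"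
    by (subst contract_commute[OF assms(2)]) (simp add: Hess_sym[OF assms(2), of i] mult.commute)
  then have hess: "contract p (\<lambda>r s. Hess c p [i, r] * ?u c p [s]) = \<kappa> * ?u c p [i]
      - contract p (\<lambda>m q. ?u c p [m] * ricci g c p q i)"
    using contract_soliton[OF assms(2), of "\<lambda>m. ?u c p [m]" i] by linarith
  have "lap ?u c p [i] - nabla (lap (scalar a)) c p [i] = contract p (\<lambda>r s.
      contract p (\<lambda>m q. ?u c p [m] * R p q s i r) + Hess c p [i, r] * ?u c p [s])"
    unfolding cov_deriv_weighted_laplacian[OF sa assms(2)] weighted_laplacian_eq_contract contract_diff[symmetric]
    by (simp add: comm hessian_sym[OF assms, of i] algebra_simps)
  then show ?thesis unfolding contract_add ric hess by simp
qed

text \<open>To move \<open>\<nabla>\<^sub>i\<close> past \<open>\<nabla>\<^sub>r\<nabla>\<^sub>s\<close>, first commute it with \<open>\<nabla>\<^sub>r\<close> on the 2-tensor \<open>\<nabla>\<omega>\<close>, then with \<open>\<nabla>\<^sub>s\<close> on \<open>\<omega>\<close>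
below \<open>\<nabla>\<^sub>r\<close>.  After contraction the curvature terms are \<open>X\<close>, which is \<open>-Ric(\<nabla>\<omega>)\<close> and combines with the
Hessian term, \<open>Y\<close> and \<open>Y'\<close>, which are both \<open>Rm(\<nabla>\<omega>)\<close>, and \<open>Z\<close>, which collects all terms in
the undifferentiated \<open>\<omega>\<close>, including the one from the drift.\<close>
lemma cov_deriv_weighted_laplacian_covector:
  assumes "smooth_tensor 1 \<omega>" "p \<in> chart_dom"
  shows "nabla (lap \<omega>) c p [i, j] = lap (nabla \<omega>) c p [i, j]
    + 2 * riemann_action g (nabla \<omega>) c p [i, j] - \<kappa> * nabla \<omega> c p [i, j]"
proof -
  let ?P = "nabla \<omega>"
  have P: "smooth_tensor 2 ?P" using smooth_tensor_cov_deriv[OF assms(1)] by (simp add: numeral_2_eq_2)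
  define X where "X r s = contract p (\<lambda>m q. ?P c p [m, j] * R p q s r i)" for r s
  define Y where "Y r s = contract p (\<lambda>m q. ?P c p [s, m] * R p q j r i)" for r s
  define Y' where "Y' r s = contract p (\<lambda>m q. ?P c p [r, m] * R p q j s i)" for r s
  define Z where "Z r s = contract p (\<lambda>m q. \<omega> c p [m] * (nabla Rm c p [r, q, j, s, i] - df c p [r] * R p q j s i))" for r s
  have third: "nabla (nabla ?P) c p [i, r, s, j] - df c p [r] * nabla ?P c p [i, s, j] =
      nabla (nabla ?P) c p [r, s, i, j] - df c p [r] * nabla ?P c p [s, i, j] + X r s + Y r s + Y' r s + Z r s" for r s
  proof -
    have "nabla (nabla ?P) c p [i, r, s, j] = nabla (nabla ?P) c p [r, i, s, j] + X r s + Y r s"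
      using ricci_identity_bilinear[OF P assms(2), of i r s j] unfolding X_def Y_def by linarith
    moreover have "nabla (nabla ?P) c p [r, i, s, j] = nabla (nabla ?P) c p [r, s, i, j] + Y' r s
        + contract p (\<lambda>m q. \<omega> c p [m] * nabla Rm c p [r, q, j, s, i])"
      using cov_deriv_ricci_identity_covector[OF assms, of r i s j]
        cov_deriv_curvature_on[OF assms, of r j s i] unfolding Y'_def by linarith
    moreover have "nabla ?P c p [i, s, j] = nabla ?P c p [s, i, j] + contract p (\<lambda>m q. \<omega> c p [m] * R p q j s i)"
      using ricci_identity_covector[OF assms, of i s j] by (simp add: metric_trace_eq_contract)
    moreover have "Z r s = contract p (\<lambda>m q. \<omega> c p [m] * nabla Rm c p [r, q, j, s, i])
        - df c p [r] * contract p (\<lambda>m q. \<omega> c p [m] * R p q j s i)"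
      unfolding Z_def contract_cmult[symmetric] contract_diff[symmetric] by (simp add: algebra_simps)
    ultimately show ?thesis by (simp add: distrib_left)
  qed
  have Z: "contract p Z = 0"
  proof -
    have "contract p Z = contract p (\<lambda>m q. contract p (\<lambda>r s. \<omega> c p [m] *
        (nabla Rm c p [r, q, j, s, i] - df c p [r] * R p q j s i)))"
      unfolding Z_def by (rule contract_contract)
    also have "\<dots> = contract p (\<lambda>m q. \<omega> c p [m] * contract p (\<lambda>r s.
        nabla Rm c p [r, s, i, q, j] - df c p [r] * R p s i q j))"
      unfolding contract_cmult
      by (simp only: cov_deriv_Rm_pair_sym[OF assms(2), of _ _ j _ i] riemann_pair_sym[OF assms(2), of _ j _ i])
    finally show ?thesis unfolding weighted_div_Rm[OF assms(2)] by (simp add: contract_def)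
  qed
  have Y: "contract p Y = riemann_action g ?P c p [i, j]"
    unfolding Y_def riemann_action_eq_contract[OF assms(2)] ..
  have Y': "contract p Y' = riemann_action g ?P c p [i, j]"
    unfolding Y[symmetric] Y_def Y'_def by (rule contract_commute[OF assms(2)])
  have X: "contract p X = - contract p (\<lambda>m q. ?P c p [m, j] * ricci g c p q i)"
  proof -
    have "contract p X = contract p (\<lambda>m q. contract p (\<lambda>r s. ?P c p [m, j] * R p q s r i))"
      unfolding X_def by (rule contract_contract)
    also have "\<dots> = contract p (\<lambda>m q. - (?P c p [m, j] * ricci g c p q i))"
      unfolding contract_cmult
      by (subst contract_commute[OF assms(2), of "\<lambda>r s. R p _ s r i"]) (simp add: contract_riemann(3)[OF assms(2)])
    finally show ?thesis by (simp only: contract_minus)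
  qed
  have H: "contract p (\<lambda>r s. Hess c p [i, r] * ?P c p [s, j]) = contract p (\<lambda>m q. ?P c p [m, j] * Hess c p [q, i])"
    by (subst contract_commute[OF assms(2)]) (simp add: Hess_sym[OF assms(2), of i] mult.commute)
  have "nabla (lap \<omega>) c p [i, j] = contract p (\<lambda>r s.
      (nabla (nabla ?P) c p [r, s, i, j] - df c p [r] * nabla ?P c p [s, i, j])
      + X r s + Y r s + Y' r s + Z r s - Hess c p [i, r] * ?P c p [s, j])"
  proof -
    have "nabla (lap \<omega>) c p [i, j] = contract p (\<lambda>r s. nabla (nabla ?P) c p [i, r, s, j]
        - Hess c p [i, r] * ?P c p [s, j] - df c p [r] * nabla ?P c p [i, s, j])"
      using assms by (intro cov_deriv_weighted_laplacian) simp_all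
    moreover have "nabla (nabla ?P) c p [i, r, s, j] - Hess c p [i, r] * ?P c p [s, j]
        - df c p [r] * nabla ?P c p [i, s, j] =
        (nabla (nabla ?P) c p [r, s, i, j] - df c p [r] * nabla ?P c p [s, i, j])
        + X r s + Y r s + Y' r s + Z r s - Hess c p [i, r] * ?P c p [s, j]" for r s
      using third[of r s] by linarith
    ultimately show ?thesis by (simp only:)
  qed
  also have "\<dots> = lap ?P c p [i, j] + contract p X + contract p Y + contract p Y' + contract p Z
      - contract p (\<lambda>r s. Hess c p [i, r] * ?P c p [s, j])"
    unfolding weighted_laplacian_eq_contract contract_add contract_diff ..
  finally show ?thesis
    using contract_soliton[OF assms(2), of "\<lambda>m. ?P c p [m, j]" i] unfolding X Y Y' Z H by linarith
qed

text \<open>The symmetrization of \<open>cov_deriv_weighted_laplacian_covector\<close>.  The zeroth order terms match since the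
\<open>-1/\<tau>\<close> in \<open>\<Delta>\<^bsub>f,L\<^esub>\<close> is \<open>-2\<kappa>\<close>.\<close>
lemma lie_deriv_weighted_laplacian:
  assumes "smooth_tensor 1 \<omega>" "p \<in> chart_dom"
  shows "lie_deriv (sharp g (lap \<omega>)) g c p [i, j] =
    weighted_lichnerowicz g f \<tau> (lie_deriv (sharp g \<omega>) g) c p [i, j] + \<kappa> * lie_deriv (sharp g \<omega>) g c p [i, j]"
proof -
  let ?L = "lie_deriv (sharp g \<omega>) g" and ?P = "nabla \<omega>"
  let ?S = "\<lambda>b q js. 1 * ?P b q js + 1 * permute_indices [1, 0] ?P b q js"
  have P: "smooth_tensor 2 ?P" using smooth_tensor_cov_deriv[OF assms(1)] by (simp add: numeral_2_eq_2)
  have L: "?L c q js = ?S c q js" if "q \<in> chart_dom" "length js = 2" for q js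
    using that lie_deriv_sharp_metric[OF assms(1)]
    by (auto simp: permute_indices_def length_Suc_conv numeral_2_eq_2)
  have lapL: "lap ?L c p [i, j] = lap ?P c p [i, j] + lap ?P c p [j, i]"
  proof -
    have "lap ?L c p [i, j] = lap ?S c p [i, j]"
      by (intro weighted_laplacian_cong assms(2) L) simp_all
    also have "\<dots> = 1 * lap ?P c p [i, j] + 1 * lap (permute_indices [1, 0] ?P) c p [i, j]"
      using P assms(2) by (intro weighted_laplacian_linear) (simp_all add: smooth_tensor_permute_indices numeral_2_eq_2)
    finally show ?thesis unfolding weighted_laplacian_transpose[OF assms(2)] by simp
  qed
  have RmL: "riemann_action g ?L c p [i, j] = riemann_action g ?P c p [i, j] + riemann_action g ?P c p [j, i]"
  proof -
    have "riemann_action g ?L c p [i, j] = riemann_action g ?S c p [i, j]"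
      unfolding riemann_action_eq_contract[OF assms(2)] by (simp add: L assms(2))
    also have "\<dots> = riemann_action g ?P c p [i, j] + riemann_action g (permute_indices [1, 0] ?P) c p [i, j]"
      unfolding riemann_action_eq_contract[OF assms(2)] by (simp only: mult_1 distrib_right contract_add)
    finally show ?thesis unfolding riemann_action_transpose[OF assms(2)] .
  qed
  have "lie_deriv (sharp g (lap \<omega>)) g c p [i, j] = nabla (lap \<omega>) c p [i, j] + nabla (lap \<omega>) c p [j, i]"
    by (rule lie_deriv_sharp_metric[OF smooth_tensor_weighted_laplacian[OF assms(1)] assms(2)])
  then show ?thesis
    unfolding cov_deriv_weighted_laplacian_covector[OF assms] weighted_lichnerowicz_def lapL RmL
    unfolding lie_deriv_sharp_metric[OF assms]
    by (simp add: algebra_simps)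
qed

text \<open>As \<open>div\<^sub>f \<omega>\<close> is the trace of \<open>\<nabla>\<omega> - \<omega> \<otimes> df\<close>, the identity follows by tracing
\<open>cov_deriv_weighted_laplacian_covector\<close> and subtracting \<open>\<langle>\<Delta>\<^sub>f\<omega>, df\<rangle>\<close>.  What is left over is
\<open>2 \<langle>Ric + Hess f, \<nabla>\<omega>\<rangle>\<close>, a multiple of the trace of \<open>\<nabla>\<omega>\<close>.\<close>
lemma weighted_div_weighted_laplacian:
  assumes "smooth_tensor 1 \<omega>" "p \<in> chart_dom"
  shows "weighted_div g f (lap \<omega>) c p [] = lap (weighted_div g f \<omega>) c p [] + \<kappa> * weighted_div g f \<omega> c p []"
proof -
  let ?P = "nabla \<omega>" and ?Q = "covector_product \<omega> df"
  define trP where "trP = contract p (\<lambda>i j. ?P c p [i, j])"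
  define N where "N = contract p (\<lambda>i j. \<omega> c p [i] * df c p [j])"
  define RmP where "RmP = contract p (\<lambda>i j. riemann_action g ?P c p [i, j])"
  define HP where "HP = contract p (\<lambda>i j. contract p (\<lambda>r s. ?P c p [r, i] * Hess c p [s, j]))"
  define LP where "LP = contract p (\<lambda>i j. lap ?P c p [i, j])"
  define LN where "LN = contract p (\<lambda>i j. lap \<omega> c p [i] * df c p [j])"
  have P: "smooth_tensor 2 ?P" using smooth_tensor_cov_deriv[OF assms(1)] by (simp add: numeral_2_eq_2)
  have Q: "smooth_tensor 2 ?Q"
    using smooth_tensor_covector_product[OF assms(1) smooth_tensor_df] by (simp add: numeral_2_eq_2)
  have lhs: "weighted_div g f (lap \<omega>) c p [] = LP + 2 * RmP - \<kappa> * trP - LN"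
    unfolding weighted_div_eq_contract cov_deriv_weighted_laplacian_covector[OF assms]
    by (simp only: contract_add contract_diff contract_cmult LP_def RmP_def trP_def LN_def)
  have "lap ?Q c p [i, j] = lap \<omega> c p [i] * df c p [j] - \<kappa> * (\<omega> c p [i] * df c p [j])
      + 2 * contract p (\<lambda>r s. ?P c p [r, i] * Hess c p [s, j])" for i j
    unfolding weighted_laplacian_covector_product[OF assms(1) smooth_tensor_df assms(2)]
      weighted_laplacian_df[OF assms(2)] by simp
  then have lapQ: "contract p (\<lambda>i j. lap ?Q c p [i, j]) = LN - \<kappa> * N + 2 * HP"
    by (simp only: contract_add contract_diff contract_cmult LN_def N_def HP_def)
  have "lap (weighted_div g f \<omega>) c p [] = lap (metric_trace (\<lambda>b q js. 1 * ?P b q js + (-1) * ?Q b q js)) c p []"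
    by (intro weighted_laplacian_cong assms(2)) (simp add: weighted_div_eq_trace)
  also have "\<dots> = contract p (\<lambda>i j. lap (\<lambda>b q js. 1 * ?P b q js + (-1) * ?Q b q js) c p [i, j])"
    using P Q by (intro weighted_laplacian_metric_trace assms(2))
      (auto simp: smooth_tensor_def intro!: smooth_diff)
  also have "\<dots> = contract p (\<lambda>i j. 1 * lap ?P c p [i, j] + (-1) * lap ?Q c p [i, j])"
    using P Q assms(2) by (subst weighted_laplacian_linear) (simp_all add: numeral_2_eq_2)
  also have "\<dots> = LP - (LN - \<kappa> * N + 2 * HP)"
    unfolding contract_add contract_cmult lapQ LP_def by simp
  finally have rhs: "lap (weighted_div g f \<omega>) c p [] = LP - (LN - \<kappa> * N + 2 * HP)" .
  have div: "weighted_div g f \<omega> c p [] = trP - N"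
    unfolding weighted_div_eq_contract trP_def N_def ..
  have "RmP + HP = \<kappa> * trP"
  proof -
    have "RmP = contract p (\<lambda>r s. contract p (\<lambda>i j. contract p (\<lambda>m q. ?P c p [s, m] * R p q j r i)))"
      unfolding RmP_def riemann_action_eq_contract[OF assms(2)] by (rule contract_contract)
    also have "\<dots> = contract p (\<lambda>r s. contract p (\<lambda>m q. contract p (\<lambda>i j. ?P c p [s, m] * R p q j r i)))"
      by (subst contract_contract) (rule refl)
    also have "\<dots> = contract p (\<lambda>r s. contract p (\<lambda>m q. ?P c p [s, m] * ricci g c p q r))"
      unfolding contract_cmult
      by (subst (3) contract_commute[OF assms(2)]) (simp add: contract_riemann(2)[OF assms(2)])
    finally have 1: "RmP = contract p (\<lambda>r s. contract p (\<lambda>m q. ?P c p [s, m] * ricci g c p q r))" .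
    have "HP = contract p (\<lambda>r s. contract p (\<lambda>i j. ?P c p [r, i] * Hess c p [s, j]))"
      unfolding HP_def by (rule contract_contract)
    also have "\<dots> = contract p (\<lambda>r s. contract p (\<lambda>m q. ?P c p [s, m] * Hess c p [q, r]))"
      by (subst contract_commute[OF assms(2)]) (simp only: Hess_sym[OF assms(2)])
    finally have 2: "HP = contract p (\<lambda>r s. contract p (\<lambda>m q. ?P c p [s, m] * Hess c p [q, r]))" .
    have "RmP + HP = contract p (\<lambda>r s. contract p (\<lambda>m q. ?P c p [s, m] * ricci g c p q r)
        + contract p (\<lambda>m q. ?P c p [s, m] * Hess c p [q, r]))"
      unfolding 1 2 contract_add ..
    also have "\<dots> = contract p (\<lambda>r s. \<kappa> * ?P c p [s, r])"
      by (simp only: contract_soliton[OF assms(2)])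
    finally have "RmP + HP = contract p (\<lambda>r s. \<kappa> * ?P c p [s, r])" .
    then show ?thesis
      unfolding contract_cmult trP_def by (subst contract_commute[OF assms(2)])
  qed
  then show ?thesis unfolding lhs rhs div right_diff_distrib by linarith
qed

end

section \<open>The commutation identities\<close>

theorem theorem1p1:
  fixes M :: "'a topology"
    and A :: "('a, 'n::finite) chart set"
    and g \<omega> :: "('a, 'n) tensor"
    and f a :: "'a \<Rightarrow> real"
    and \<tau> :: real
  assumes "closed_orientable_gradient_ricci_shrinker M A g f \<tau>"
    and "tensor_field A 1 \<omega>"
    and "smooth_function A a"
  shows "(\<forall>c\<in>A. \<forall>p\<in>fst c. \<forall>i.
            weighted_laplacian g f (differential (scalar a)) c p [i] =
              differential (weighted_laplacian g f (scalar a)) c p [i]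
              + 1 / (2 * \<tau>) * differential (scalar a) c p [i])
       \<and> (\<forall>c\<in>A. \<forall>p\<in>fst c.
            weighted_div g f (weighted_laplacian g f \<omega>) c p [] =
              weighted_laplacian g f (weighted_div g f \<omega>) c p []
              + 1 / (2 * \<tau>) * weighted_div g f \<omega> c p [])
       \<and> (\<forall>c\<in>A. \<forall>p\<in>fst c. \<forall>i j.
            lie_deriv (sharp g (weighted_laplacian g f \<omega>)) g c p [i, j] =
              weighted_lichnerowicz g f \<tau> (lie_deriv (sharp g \<omega>) g) c p [i, j]
              + 1 / (2 * \<tau>) * lie_deriv (sharp g \<omega>) g c p [i, j])"
proof -
  have chart: "shrinker_chart c g f \<tau> \<and> coordinate_chart.smooth_tensor c 1 \<omega> \<and> coordinate_chart.smooth c a"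
    if c: "c \<in> A" for c
  proof -
    note S = assms(1)[unfolded closed_orientable_gradient_ricci_shrinker_def]
    have ch: "is_chart M c"
      using S c unfolding smooth_manifold_def smooth_structure_def by blast
    have "topspace (subtopology M (fst c)) = fst c"
      using ch openin_subset unfolding is_chart_def by (fastforce simp: topspace_subtopology)
    then have "inj_on (snd c) (fst c)"
      using ch homeomorphic_imp_injective_map unfolding is_chart_def by fastforce
    then interpret coordinate_chart c
      using ch by unfold_locales (auto simp: is_chart_def)
    have T: "smooth (\<lambda>p. T c p is)" if "tensor_field A k T" "length is = k" for T k "is"
      using that c unfolding tensor_field_def smooth_def by blast
    interpret riemannian_chart c g
      using S c by unfold_locales (auto simp: riemannian_metric_def intro!: T)
    have "smooth f" "smooth a"
      using S assms(3) c unfolding smooth_function_def smooth_def by blast+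
    moreover have "smooth_tensor 1 \<omega>" using T[OF assms(2)] by (simp add: smooth_tensor_def)
    ultimately show ?thesis
      using S c by (auto intro!: shrinker_chart.intro weighted_riemannian_chart.intro
          shrinker_chart_axioms.intro weighted_riemannian_chart_axioms.intro riemannian_chart_axioms)
  qed
  have d: "differential T c p [i] = cov_deriv g T c p [i]" for T c p i
    by (simp add: differential_def cov_deriv_Cons)
  show ?thesis
  proof (intro conjI ballI allI)
    fix c p i j assume c: "c \<in> A" and p: "p \<in> fst c"
    interpret shrinker_chart c g f \<tau> using chart[OF c] by blast
    have \<omega>: "smooth_tensor 1 \<omega>" and a: "smooth a" using chart[OF c] by blast+
    \<comment> \<open>\<open>differential\<close> and \<open>\<nabla>\<close> agree on a scalar only at index lists of length one.\<close>
    have "lap (differential (scalar a)) c p [i] = lap (nabla (scalar a)) c p [i]"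
      by (intro weighted_laplacian_cong p) (auto simp: length_Suc_conv d)
    then show "lap (differential (scalar a)) c p [i] =
        differential (lap (scalar a)) c p [i] + \<kappa> * differential (scalar a) c p [i]"
      unfolding d using weighted_laplacian_differential[OF a p] by simp
    show "weighted_div g f (lap \<omega>) c p [] = lap (weighted_div g f \<omega>) c p [] + \<kappa> * weighted_div g f \<omega> c p []"
      by (rule weighted_div_weighted_laplacian[OF \<omega> p])
    show "lie_deriv (sharp g (lap \<omega>)) g c p [i, j] =
        weighted_lichnerowicz g f \<tau> (lie_deriv (sharp g \<omega>) g) c p [i, j] + \<kappa> * lie_deriv (sharp g \<omega>) g c p [i, j]"
      by (rule lie_deriv_weighted_laplacian[OF \<omega> p])
  qed
qed

end
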